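(* Let $r\in(0,1)$ be $E$-large enough, let $s\in(r,1)$ and let $Z$ be a Banach space. There exist a constant $C>0$ and a sequence $(\Phi_i)_{i\ge 1}$ in $H_0^\infty(E_r)$ such that $$\sup_{z\in E_r}\sum_{i=1}^\infty|\Phi_i(z)|^{1/2}<\infty,$$ and for any $h\in H^\infty(E_s;Z)$ there exists a bounded sequence $(\alpha_i)_{i\ge1}$ in $Z$ such that $$h(z)=\sum_{i=1}^\infty\alpha_i\Phi_i(z)\quad\text{for all }z\in E_r,\qquad\text{and}\qquad \|\alpha_i\|_Z\le C\|h\|_{\infty,E_s}\quad\text{for all }i\ge1.$$
   Context: $E=\{\xi_1,\dots,\xi_N\}$ is a fixed finite subset ($N\ge1$, distinct points) of the unit circle $\mathbb T\subset\mathbb C$, and $\mathbb D$ is the open unit disc. For $r\in(0,1)$, $E_r$ denotes the interior of the convex hull of $E\cup r\mathbb D$. One says that $r$ is $E$-large enough if every segment $[\xi_i,\xi_j]$ with $i\ne j$ meets the open disc $r\mathbb D$ (so that $\partial E_r$ consists of the segments issued from the points $\xi_j$ and tangent to $r\mathbb T$, together with arcs of $r\mathbb T$ joining segments issued from consecutive points of $E$). $H_0^\infty(E_r)$ is the space of bounded holomorphic functions $\phi:E_r\to\mathbb C$ for which there exist $C_1>0$ and $s_1,\dots,s_N>0$ with $|\phi(z)|\le C_1\prod_{j=1}^N|\xi_j-z|^{s_j}$ for all $z\in E_r$. For a Banach space $Z$, $H^\infty(E_s;Z)$ is the Banach space of all bounded holomorphic functions $f:E_s\to Z$ with norm $\|f\|_{\infty,E_s}=\sup\{\|f(z)\|_Z: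 z\in E_s\}$. *)

theory Defs
  imports "HOL-Complex_Analysis.Complex_Analysis"
begin

text \<open>
  Complex normed and Banach spaces, as real ones whose scalar multiplication extends to the
  complex numbers; \<^term>\<open>scaleR\<close> is its restriction to the reals, so that
  \<open>scaleC 1 x = x\<close> is inherited from the real structure.
\<close>

class complex_normed_vector = real_normed_vector +
  fixes scaleC :: "complex \<Rightarrow> 'a \<Rightarrow> 'a" (infixr "*\<^sub>C" 75)
  assumes scaleC_add_right: "a *\<^sub>C (x + y) = a *\<^sub>C x + a *\<^sub>C y"
    and scaleC_add_left: "(a + b) *\<^sub>C x = a *\<^sub>C x + b *\<^sub>C x"
    and scaleC_scaleC: "a *\<^sub>C b *\<^sub>C x = (a * b) *\<^sub>C x"
    and scaleR_scaleC: "scaleR t x = complex_of_real t *\<^sub>C x"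
    and norm_scaleC: "norm (a *\<^sub>C x) = cmod a * norm x"

class complex_banach = complex_normed_vector + complete_space

subclass (in complex_banach) banach ..

instantiation complex :: complex_banach
begin

definition scaleC_complex :: "complex \<Rightarrow> complex \<Rightarrow> complex"
  where "scaleC_complex a x = a * x"

instance
  by standard (simp_all add: scaleC_complex_def algebra_simps norm_mult scaleR_conv_of_real)

end

text \<open>
  The library's \<open>holomorphic_on\<close> only covers complex-valued functions. As there, the derivative is
  a Frechet derivative given by multiplication with a fixed element.
\<close>

definition vholomorphic_on :: "(complex \<Rightarrow> 'z::complex_normed_vector) \<Rightarrow> complex set \<Rightarrow> bool"
    (infixl "(vholomorphic'_on)" 50)
  where "f vholomorphic_on S \<longleftrightarrow>
    (\<forall>z\<in>S. \<exists>D. (f has_derivative (\<lambda>w. w *\<^sub>C D)) (at z within S))"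

lemma vholomorphic_on_complex_iff:
  fixes f :: "complex \<Rightarrow> complex"
  shows "f vholomorphic_on S \<longleftrightarrow> f holomorphic_on S"
  by (simp add: vholomorphic_on_def holomorphic_on_def field_differentiable_def
      has_field_derivative_def scaleC_complex_def mult.commute)

definition E_dom :: "complex set \<Rightarrow> real \<Rightarrow> complex set"
  where "E_dom E r = interior (convex hull (E \<union> ball 0 r))"

definition E_large_enough :: "complex set \<Rightarrow> real \<Rightarrow> bool"
  where "E_large_enough E r \<longleftrightarrow>
    (\<forall>\<xi>\<in>E. \<forall>\<eta>\<in>E. \<xi> \<noteq> \<eta> \<longrightarrow> closed_segment \<xi> \<eta> \<inter> ball 0 r \<noteq> {})"

text \<open>
  Functions are total, so elements of the function spaces below are only relevant on the domain.
  The exponents are indexed by the points of \<open>E\<close> themselves.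
\<close>

definition H0_inf :: "complex set \<Rightarrow> real \<Rightarrow> (complex \<Rightarrow> complex) set"
  where "H0_inf E r = {\<phi>. \<phi> holomorphic_on E_dom E r \<and> bounded (\<phi> ` E_dom E r) \<and>
    (\<exists>C\<^sub>1>0. \<exists>s :: complex \<Rightarrow> real. (\<forall>\<xi>\<in>E. s \<xi> > 0) \<and>
      (\<forall>z\<in>E_dom E r. cmod (\<phi> z) \<le> C\<^sub>1 * (\<Prod>\<xi>\<in>E. cmod (\<xi> - z) powr s \<xi>)))}"

definition H_inf :: "complex set \<Rightarrow> (complex \<Rightarrow> 'z::complex_banach) set"
  where "H_inf U = {f. f vholomorphic_on U \<and> bounded (f ` U)}"

definition H_inf_norm :: "complex set \<Rightarrow> (complex \<Rightarrow> 'z::complex_banach) \<Rightarrow> real"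
  where "H_inf_norm U f = (SUP z\<in>U. norm (f z))"

end

theory Submission
  imports Defs
begin

text \<open>
  Let \<open>g\<close> be the product of the functions \<open>csqrt (1 - cnj \<xi> * z)\<close>, which vanishes to order \<open>1/2\<close> at every
  \<open>\<xi>\<close> in \<open>E\<close>. Cauchy's formula for \<open>f / g\<close> on a contour between \<open>E_dom E r\<close> and \<open>E_dom E s\<close> gives
  \<open>2 \<pi> \<i> f z = \<integral> f w * (g z / g w) / (w - z) dw\<close>. For \<open>r < t < s\<close> and \<open>cos \<beta> = r\<close> the contour consists of the
  segments from each \<open>\<xi>\<close> to \<open>t * \<xi> * cis (\<plusminus>\<beta>)\<close> and of arcs of the circle of radius \<open>t\<close>; since every line
  \<open>{z. inner (\<xi> * cis (\<plusminus>\<beta>)) z = r}\<close> supports \<open>E_dom E r\<close>, the distance of a contour point to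
  \<open>E_dom E r\<close> is comparable to its distance to \<open>E\<close>. Each piece is cut geometrically towards its corner at
  \<open>\<rho> ^ (4 * k)\<close>, and on the \<open>k\<close>-th cell \<open>1 / (w - z)\<close> is expanded in a geometric series
  about an endpoint of the cell. The exponent \<open>1/2\<close> makes the \<open>k\<close>-th atom at most a constant times
  \<open>min (a / \<rho> ^ (2 * k)) (\<rho> ^ (2 * k) / a)\<close> with \<open>a = cmod (g z)\<close>, so that the square roots still have bounded sum.
  Vector-valued functions reduce to scalar ones because bounded functionals separate points.
\<close>

section \<open>Separating functionals\<close>

text \<open>The points of \<open>E\<close> lie on the boundary of both domains, so the contour
  cannot keep a positive distance from \<open>E_dom E r\<close>: it runs into the corners, and no
  single expansion of the kernel works near them. Without the factor \<open>g z / g w\<close>, each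
  cell farther from a corner than \<open>z\<close> would contribute an atom of size about one, and
  the sum would grow logarithmically as \<open>z\<close> approaches \<open>E\<close>. Weighting by a
  power of the distance strictly between 0 and 1 yields decay on both sides: the weight handles the
  larger cells, the kernel the smaller ones. Cutting at fourth powers of \<rho> keeps both the
  weight and the square roots of the atoms in integer powers. The variable \<open>z\<close> enters
  only the atoms and \<open>h\<close> only the coefficients, so one sequence of atoms serves all
  \<open>h\<close>. Since \<open>1 / g\<close> blows up at the corners, Cauchy's formula is a limit
  over truncated contours; the truncated integrals are evaluated by primitives, and the total turn
  of the contour supplies \<open>2 \<pi> \<i>\<close>. Largeness of \<open>r\<close> enters as an
  angular gap of at least \<open>2 * \<beta>\<close> between neighbouring points of
  \<open>E\<close>.\<close>

definition sublinear :: "('a::real_vector \<Rightarrow> real) \<Rightarrow> bool"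
  where "sublinear p \<longleftrightarrow> (\<forall>x y. p (x + y) \<le> p x + p y) \<and> (\<forall>c>0. \<forall>x. p (c *\<^sub>R x) \<le> c * p x)"

lemma sublinear_add: "sublinear p \<Longrightarrow> p (x + y) \<le> p x + p y"
  by (simp add: sublinear_def)

text \<open>Applying the defining inequality with \<open>inverse c\<close> at
  \<open>c *\<^sub>R x\<close> gives the reverse one, so only one direction has to be checked for
  the infima constructed below.\<close>

lemma sublinear_scale:
  assumes "sublinear p" "c > 0"
  shows "p (c *\<^sub>R x) = c * p x"
proof (rule antisym)
  have "p (inverse c *\<^sub>R (c *\<^sub>R x)) \<le> inverse c * p (c *\<^sub>R x)"
    using assms unfolding sublinear_def by (meson positive_imp_inverse_positive)
  with assms(2) show "c * p x \<le> p (c *\<^sub>R x)"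
    by (simp add: field_simps)
qed (use assms in \<open>simp add: sublinear_def\<close>)

lemma sublinear_zero:
  assumes "sublinear p" shows "p 0 = 0"
  using sublinear_scale[OF assms, of 2 0] by simp

lemma sublinear_neg: "sublinear p \<Longrightarrow> - p (- x) \<le> p x"
  using sublinear_add[of p x "- x"] by (simp add: sublinear_zero)

text \<open>Hence a minimal sublinear functional is odd, and therefore linear.\<close>

lemma sublinear_lower:
  assumes p: "sublinear p"
  shows "\<exists>p'. sublinear p' \<and> (\<forall>x. p' x \<le> p x) \<and> p' (- y) \<le> - p y"
proof -
  let ?q = "\<lambda>x t. p (x + t *\<^sub>R y) - t * p y"
  \<comment> \<open>The largest candidate: a sublinear \<open>q\<close> below \<open>p\<close> with
    \<open>q (- y) \<le> - p y\<close> must satisfy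
    \<open>q x \<le> q (x + t *\<^sub>R y) + t * q (- y)\<close>, which is at most
    \<open>?q x t\<close> for every \<open>t \<ge> 0\<close>.\<close>
  define p' where "p' x = (INF t\<in>{0..}. ?q x t)" for x
  have "- p (- x) \<le> ?q x t" if "t \<ge> 0" for x t
  proof (cases "t = 0")
    case True then show ?thesis using sublinear_neg[OF p, of x] by simp
  next
    case False
    then show ?thesis
      using that sublinear_add[OF p, of "x + t *\<^sub>R y" "- x"] sublinear_scale[OF p, of t y] by simp
  qed
  then have bdd: "bdd_below (?q x ` {0..})" for x
    by (intro bdd_belowI2[where m = "- p (- x)"]) auto
  have lower: "p' x \<le> ?q x t" if "t \<ge> 0" for x t
    unfolding p'_def by (rule cINF_lower[OF bdd]) (use that in auto)
  have "p' (x1 + x2) \<le> p' x1 + p' x2" for x1 x2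
  proof -
    have 1: "p' (x1 + x2) - ?q x2 t2 \<le> ?q x1 t1" if "t1 \<ge> 0" "t2 \<ge> 0" for t1 t2
    proof -
      have "p' (x1 + x2) \<le> ?q (x1 + x2) (t1 + t2)"
        using that by (intro lower) auto
      also have "\<dots> \<le> ?q x1 t1 + ?q x2 t2"
        using sublinear_add[OF p, of "x1 + t1 *\<^sub>R y" "x2 + t2 *\<^sub>R y"] by (simp add: algebra_simps)
      finally show ?thesis by simp
    qed
    have "p' (x1 + x2) - ?q x2 t2 \<le> p' x1" if "t2 \<ge> 0" for t2
      unfolding p'_def[of x1] using 1 that by (intro cINF_greatest) auto
    then have "p' (x1 + x2) - p' x1 \<le> ?q x2 t2" if "t2 \<ge> 0" for t2
      using that by (smt (verit))
    then have "p' (x1 + x2) - p' x1 \<le> p' x2"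
      unfolding p'_def[of x2] by (intro cINF_greatest) auto
    then show ?thesis by simp
  qed
  moreover have "p' (c *\<^sub>R x) \<le> c * p' x" if c: "c > 0" for c x
  proof -
    have "p' (c *\<^sub>R x) / c \<le> ?q x t" if "t \<ge> 0" for t
    proof -
      have "p' (c *\<^sub>R x) \<le> ?q (c *\<^sub>R x) (c * t)"
        using that c by (intro lower) auto
      also have "\<dots> = c * ?q x t"
        using sublinear_scale[OF p c, of "x + t *\<^sub>R y"] by (simp add: algebra_simps)
      finally show ?thesis using c by (simp add: field_simps)
    qed
    then have "p' (c *\<^sub>R x) / c \<le> p' x"
      unfolding p'_def[of x] by (intro cINF_greatest) auto
    then show ?thesis using c by (simp add: field_simps)
  qed
  moreover have "p' x \<le> p x" for x using lower[of 0 x] by simp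
  moreover have "p' (- y) \<le> - p y" using lower[of 1 "- y"] by (simp add: sublinear_zero[OF p])
  ultimately show ?thesis unfolding sublinear_def by blast
qed

text \<open>Zorn's lemma for the reversed pointwise order. The infimum over a chain is finite
  because each member satisfies \<open>- p0 (- x) \<le> - p (- x) \<le> p x\<close>, and it is
  subadditive because two members of a chain can be replaced by the smaller one.\<close>

lemma exists_minimal_sublinear:
  assumes p0: "sublinear p0"
  obtains m where "sublinear m" "\<And>x. m x \<le> p0 x"
    "\<And>p. sublinear p \<Longrightarrow> (\<And>x. p x \<le> m x) \<Longrightarrow> p = m"
proof -
  let ?A = "{p. sublinear p \<and> (\<forall>x. p x \<le> p0 x)}"
  let ?P = "\<lambda>p q. \<forall>x. q x \<le> p x"
  have "\<exists>m\<in>?A. \<forall>a\<in>?A. ?P m a \<longrightarrow> a = m"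
  proof (rule predicate_Zorn)
    show "partial_order_on ?A (relation_of ?P ?A)"
      by (rule partial_order_on_relation_ofI) (auto intro: order_trans ext simp: order_antisym)
    fix C assume "C \<in> Chains (relation_of ?P ?A)"
    then have CA: "C \<subseteq> ?A" and total: "\<And>p q. p \<in> C \<Longrightarrow> q \<in> C \<Longrightarrow> ?P p q \<or> ?P q p"
      by (auto simp: Chains_def relation_of_def)
    show "\<exists>u\<in>?A. \<forall>a\<in>C. ?P a u"
    proof (cases "C = {}")
      case True then show ?thesis using p0 by blast
    next
      case False
      define u where "u x = (INF p\<in>C. p x)" for x
      have "- p0 (- x) \<le> p x" if "p \<in> C" for p x
      proof -
        have "sublinear p" "p (- x) \<le> p0 (- x)" using CA that by auto
        then show ?thesis using sublinear_neg[of p x] by linarith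
      qed
      then have bdd: "bdd_below ((\<lambda>p. p x) ` C)" for x
        by (intro bdd_belowI2[where m = "- p0 (- x)"]) auto
      have lower: "u x \<le> p x" if "p \<in> C" for p x
        unfolding u_def by (rule cINF_lower[OF bdd]) (use that in auto)
      have "u (x + y) \<le> u x + u y" for x y
      proof -
        have 1: "u (x + y) - q y \<le> p x" if pq: "p \<in> C" "q \<in> C" for p q
        proof -
          obtain p' where p': "p' \<in> C" "p' x \<le> p x" "p' y \<le> q y"
            using total[OF pq] pq by (metis order_refl)
          then have "p' (x + y) \<le> p' x + p' y" using CA by (auto intro: sublinear_add)
          then show ?thesis using p' lower[of p' "x + y"] by linarith
        qed
        have "u (x + y) - q y \<le> u x" if "q \<in> C" for q
          unfolding u_def[of x] using 1 that False by (intro cINF_greatest) auto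
        then have "u (x + y) - u x \<le> q y" if "q \<in> C" for q
          using that by (smt (verit))
        then have "u (x + y) - u x \<le> u y"
          unfolding u_def[of y] using False by (intro cINF_greatest) auto
        then show ?thesis by simp
      qed
      moreover have "u (c *\<^sub>R x) \<le> c * u x" if c: "c > 0" for c x
      proof -
        have "u (c *\<^sub>R x) / c \<le> p x" if "p \<in> C" for p
        proof -
          have "p (c *\<^sub>R x) = c * p x" using CA that c by (auto intro: sublinear_scale)
          then show ?thesis using lower[OF that, of "c *\<^sub>R x"] c by (simp add: field_simps)
        qed
        then have "u (c *\<^sub>R x) / c \<le> u x"
          unfolding u_def[of x] using False by (intro cINF_greatest) auto
        then show ?thesis using c by (simp add: field_simps)
      qed
      moreover have "u x \<le> p0 x" for x
      proof -
        obtain p where "p \<in> C" using False by blast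
        then have "u x \<le> p x" "p x \<le> p0 x" using lower CA by auto
        then show ?thesis by linarith
      qed
      ultimately show ?thesis using lower unfolding sublinear_def by blast
    qed
  qed
  then obtain m where m: "sublinear m" "\<And>x. m x \<le> p0 x"
    and min: "\<And>p. p \<in> ?A \<Longrightarrow> ?P m p \<Longrightarrow> p = m" by auto
  show ?thesis
  proof (rule that[OF m])
    fix p assume "sublinear p" "\<And>x. p x \<le> m x"
    then show "p = m" using m(2) by (intro min) (auto intro: order_trans)
  qed
qed

text \<open>A minimal sublinear functional is linear, but one below the norm could vanish at
  \<open>x0\<close>. The search therefore starts below a \<open>p0\<close> that is already at most
  \<open>- norm x0\<close> at \<open>- x0\<close>, which forces the value at \<open>x0\<close> to be
  at least \<open>norm x0\<close>.\<close>

lemma exists_separating_functional: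
  fixes x0 :: "'a::real_normed_vector"
  assumes "x0 \<noteq> 0"
  obtains f :: "'a \<Rightarrow> real" where "bounded_linear f" "f x0 \<noteq> 0"
proof -
  have nrm: "sublinear (norm :: 'a \<Rightarrow> real)"
    by (simp add: sublinear_def norm_triangle_ineq)
  obtain p0 where p0: "sublinear p0" "\<And>x. p0 x \<le> norm x" "p0 (- x0) \<le> - norm x0"
    using sublinear_lower[OF nrm] by metis
  obtain m where m: "sublinear m" "\<And>x. m x \<le> p0 x"
    and min: "\<And>p. sublinear p \<Longrightarrow> (\<And>x. p x \<le> m x) \<Longrightarrow> p = m"
    using exists_minimal_sublinear[OF p0(1)] by blast
  have odd: "m (- x) = - m x" for x
  proof -
    obtain p' where "sublinear p'" "\<And>z. p' z \<le> m z" "p' (- x) \<le> - m x"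
      using sublinear_lower[OF m(1)] by metis
    with min[of p'] sublinear_neg[OF m(1), of x] show ?thesis by auto
  qed
  have add: "m (x + y) = m x + m y" for x y
    using sublinear_add[OF m(1), of x y] sublinear_add[OF m(1), of "x + y" "- y"] odd[of y] by simp
  have scale: "m (c *\<^sub>R x) = c * m x" for c x
    using sublinear_scale[OF m(1), of c x] sublinear_scale[OF m(1), of "- c" x] odd[of "c *\<^sub>R x"]
      sublinear_zero[OF m(1)]
    by (cases "c = 0"; cases "c > 0") auto
  have le: "m x \<le> norm x" for x using m(2) p0(2) order_trans by blast
  have "bounded_linear m"
  proof (rule bounded_linear_intro[where K = 1])
    show "norm (m x) \<le> norm x * 1" for x
      using le[of x] le[of "- x"] odd[of x] by simp
  qed (simp_all add: add scale)
  moreover have "m x0 \<noteq> 0"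
    using m(2)[of "- x0"] p0(3) odd[of x0] assms by (smt (verit) norm_le_zero_iff)
  ultimately show ?thesis using that by blast
qed

lemma scaleC_zero_left [simp]: "0 *\<^sub>C x = 0"
  by (metis norm_scaleC norm_eq_zero mult_zero_left)

lemma bounded_bilinear_scaleC:
  "bounded_bilinear (scaleC :: complex \<Rightarrow> 'z::complex_normed_vector \<Rightarrow> 'z)"
proof
  fix a b :: complex and x y :: 'z and t :: real
  show "(t *\<^sub>R a) *\<^sub>C x = t *\<^sub>R (a *\<^sub>C x)"
    by (simp add: scaleR_scaleC[of t "a *\<^sub>C x"] scaleC_scaleC scaleR_conv_of_real)
  show "a *\<^sub>C (t *\<^sub>R x) = t *\<^sub>R (a *\<^sub>C x)"
    by (simp add: scaleR_scaleC scaleC_scaleC mult.commute)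
  show "\<exists>K. \<forall>a (x :: 'z). norm (a *\<^sub>C x) \<le> norm a * norm x * K"
    by (rule exI[of _ 1]) (simp add: norm_scaleC)
qed (simp_all add: scaleC_add_left scaleC_add_right)

lemma exists_separating_complex_functional:
  fixes x0 :: "'z::complex_normed_vector"
  assumes "x0 \<noteq> 0"
  obtains \<phi> :: "'z \<Rightarrow> complex"
  where "bounded_linear \<phi>" "\<And>a x. \<phi> (a *\<^sub>C x) = a * \<phi> x" "\<phi> x0 \<noteq> 0"
proof -
  obtain f :: "'z \<Rightarrow> real" where f: "bounded_linear f" "f x0 \<noteq> 0"
    using exists_separating_functional[OF assms] by blast
  \<comment> \<open>The only complex linear functional with real part \<open>f\<close>.\<close>
  define \<phi> where "\<phi> x = of_real (f x) - \<i> * of_real (f (\<i> *\<^sub>C x))" for x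
  have bl: "bounded_linear \<phi>"
    unfolding \<phi>_def
    by (intro bounded_linear_sub bounded_linear_compose[OF bounded_linear_of_real]
        bounded_linear_compose[OF bounded_linear_mult_right] f(1)
        bounded_linear_compose[OF f(1)] bounded_bilinear.bounded_linear_right[OF bounded_bilinear_scaleC])
  have f_scale: "f (of_real t *\<^sub>C x) = t * f x" for t x
    using linear_simps(5)[OF f(1), of t x] by (simp add: scaleR_scaleC)
  have "\<phi> (a *\<^sub>C x) = a * \<phi> x" for a x
  proof -
    have "a *\<^sub>C x = of_real (Re a) *\<^sub>C x + of_real (Im a) *\<^sub>C \<i> *\<^sub>C x"
      by (simp add: scaleC_scaleC mult.commute flip: scaleC_add_left complex_eq)
    moreover have "\<i> *\<^sub>C a *\<^sub>C x = of_real (Re a) *\<^sub>C \<i> *\<^sub>C x + of_real (- Im a) *\<^sub>C x"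
      by (simp add: scaleC_scaleC flip: scaleC_add_left, rule arg_cong[of _ _ "\<lambda>c. c *\<^sub>C x"])
        (simp add: complex_eq_iff)
    ultimately show ?thesis
      unfolding \<phi>_def
      by (simp only: linear_simps(1)[OF f(1)] f_scale) (simp add: complex_eq_iff algebra_simps)
  qed
  moreover have "\<phi> x0 \<noteq> 0"
    using f(2) by (simp add: \<phi>_def complex_eq_iff)
  ultimately show ?thesis using that bl by blast
qed

section \<open>The corner weight\<close>

text \<open>The terms peak near the first index \<open>k1\<close> with
  \<open>\<rho> ^ k1 < b\<close>. The first alternative decays geometrically below it and the second
  above it, and each half sums to at most \<open>1 / (1 - \<rho>)\<close>. Independence of
  \<open>b\<close> is what makes the final bound uniform in \<open>z\<close> up to the
  corners.\<close>

lemma sum_two_sided_geometric_le: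
  fixes \<rho> b :: real
  assumes \<rho>: "0 < \<rho>" "\<rho> < 1" and b: "b > 0"
  shows "(\<Sum>k<n. min (b / \<rho> ^ k) (\<rho> ^ k / b)) \<le> 2 / (1 - \<rho>)"
proof -
  define k1 where "k1 = (LEAST k. \<rho> ^ k < b)"
  have "\<exists>k. \<rho> ^ k < b" using real_arch_pow_inv[OF b \<rho>(2)] .
  then have k1: "\<rho> ^ k1 < b" unfolding k1_def by (rule LeastI_ex)
  have k1': "b \<le> \<rho> ^ k" if "k < k1" for k
    using not_less_Least[of k "\<lambda>k. \<rho> ^ k < b"] that by (simp add: k1_def not_less)
  have geo: "(\<Sum>k<m. \<rho> ^ k) \<le> 1 / (1 - \<rho>)" for m
    using \<rho> by (simp add: sum_gp_strict divide_right_mono)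
  have low: "min (b / \<rho> ^ k) (\<rho> ^ k / b) \<le> \<rho> ^ (k1 - Suc k)" if "k < k1" for k
  proof -
    have "b \<le> \<rho> ^ k * \<rho> ^ (k1 - Suc k)"
      using k1'[of "k1 - 1"] that by (simp flip: power_add)
    then have "b / \<rho> ^ k \<le> \<rho> ^ (k1 - Suc k)"
      using \<rho> by (simp add: divide_le_eq mult.commute)
    then show ?thesis by linarith
  qed
  have high: "min (b / \<rho> ^ (k1 + k)) (\<rho> ^ (k1 + k) / b) \<le> \<rho> ^ k" for k
  proof -
    have "\<rho> ^ (k1 + k) \<le> \<rho> ^ k * b"
      using k1 \<rho> by (simp add: power_add)
    then have "\<rho> ^ (k1 + k) / b \<le> \<rho> ^ k"
      using b by (simp add: divide_le_eq)
    then show ?thesis by linarith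
  qed
  have "(\<Sum>k<n. min (b / \<rho> ^ k) (\<rho> ^ k / b)) \<le> (\<Sum>k<k1 + n. min (b / \<rho> ^ k) (\<rho> ^ k / b))"
    using \<rho> b by (intro sum_mono2) auto
  also have "\<dots> = (\<Sum>k<k1. min (b / \<rho> ^ k) (\<rho> ^ k / b)) + (\<Sum>k<n. min (b / \<rho> ^ (k1 + k)) (\<rho> ^ (k1 + k) / b))"
    by (induction n) (auto simp: add.assoc)
  also have "\<dots> \<le> (\<Sum>k<k1. \<rho> ^ (k1 - Suc k)) + (\<Sum>k<n. \<rho> ^ k)"
    by (intro add_mono sum_mono) (use low high in auto)
  also have "\<dots> = (\<Sum>k<k1. \<rho> ^ k) + (\<Sum>k<n. \<rho> ^ k)"
    by (simp add: sum.nat_diff_reindex)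
  also have "\<dots> \<le> 1 / (1 - \<rho>) + 1 / (1 - \<rho>)"
    by (intro add_mono geo)
  finally show ?thesis by simp
qed

text \<open>The form \<open>1 - cnj \<xi> * z\<close> has the modulus of \<open>\<xi> - z\<close>
  but lies in the right half plane for \<open>z\<close> in the unit disc, where the principal root
  is holomorphic.\<close>

definition corner_weight :: "complex set \<Rightarrow> complex \<Rightarrow> complex"
  where "corner_weight E z = (\<Prod>\<xi>\<in>E. csqrt (1 - cnj \<xi> * z))"

lemma norm_one_minus_cnj_mult:
  assumes "cmod \<xi> = 1" shows "cmod (1 - cnj \<xi> * z) = cmod (\<xi> - z)"
proof -
  have "1 - cnj \<xi> * z = cnj \<xi> * (\<xi> - z)"
    using assms by (simp add: algebra_simps complex_norm_square[symmetric])
  then show ?thesis using assms by (simp add: norm_mult)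
qed

lemma norm_corner_weight:
  assumes "E \<subseteq> sphere 0 1"
  shows "cmod (corner_weight E z) = (\<Prod>\<xi>\<in>E. cmod (\<xi> - z) powr (1/2))"
  unfolding corner_weight_def prod_norm[symmetric] norm_csqrt
  using assms by (intro prod.cong) (auto simp: norm_one_minus_cnj_mult powr_half_sqrt)

lemma norm_corner_weight_sq:
  assumes "E \<subseteq> sphere 0 1"
  shows "(cmod (corner_weight E z))\<^sup>2 = (\<Prod>\<xi>\<in>E. cmod (\<xi> - z))"
  unfolding norm_corner_weight[OF assms]
  by (simp add: powr_half_sqrt prod_power_distrib)

lemma holomorphic_corner_weight:
  assumes "E \<subseteq> sphere 0 1"
  shows "corner_weight E holomorphic_on ball 0 1"
proof -
  have "1 - cnj \<xi> * z \<notin> \<real>\<^sub>\<le>\<^sub>0" if "\<xi> \<in> E" "z \<in> ball 0 1" for \<xi> z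
  proof -
    have "Re (cnj \<xi> * z) \<le> cmod (cnj \<xi> * z)" by (rule complex_Re_le_cmod)
    also have "\<dots> < 1" using that assms by (auto simp: norm_mult)
    finally show ?thesis by (auto simp: complex_nonpos_Reals_iff)
  qed
  then show ?thesis
    unfolding corner_weight_def[abs_def] by (intro holomorphic_intros) auto
qed

lemma corner_weight_nonzero:
  assumes "finite E" "E \<subseteq> sphere 0 1" "z \<in> ball 0 1"
  shows "corner_weight E z \<noteq> 0"
proof -
  have "1 - cnj \<xi> * z \<noteq> 0" if "\<xi> \<in> E" for \<xi>
    using norm_one_minus_cnj_mult[of \<xi> z] that assms by auto
  then show ?thesis using assms(1) by (simp add: corner_weight_def)
qed

text \<open>At most one factor can be small: if \<open>w\<close> is within \<open>m\<close> of
  \<open>\<xi>0\<close>, with \<open>m\<close> at most half the distance from \<open>\<xi>0\<close>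
  to the other points, all other factors are at least \<open>m\<close>. Hence the bound is linear in
  \<open>d\<close>, where estimating every factor by \<open>d\<close> would give
  \<open>d ^ card E\<close>.\<close>

lemma prod_dist_lower_bound:
  assumes "finite (E :: complex set)"
  shows "\<exists>c>0. \<forall>w d. 0 \<le> d \<longrightarrow> d \<le> 1 \<longrightarrow> (\<forall>\<xi>\<in>E. d \<le> cmod (\<xi> - w)) \<longrightarrow> c * d \<le> (\<Prod>\<xi>\<in>E. cmod (\<xi> - w))"
  using assms
proof (induction E)
  case empty
  then show ?case by (intro exI[of _ 1]) auto
next
  case (insert \<xi>0 E)
  then obtain c where c: "c > 0" and
    cd: "\<And>w d. 0 \<le> d \<Longrightarrow> d \<le> 1 \<Longrightarrow> (\<forall>\<xi>\<in>E. d \<le> cmod (\<xi> - w)) \<Longrightarrow> c * d \<le> (\<Prod>\<xi>\<in>E. cmod (\<xi> - w))"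
    by auto
  obtain m where m: "0 < m" "m \<le> 1" "\<And>\<xi>. \<xi> \<in> E \<Longrightarrow> 2 * m \<le> cmod (\<xi> - \<xi>0)"
  proof -
    obtain d where "d > 0" "\<forall>x\<in>E. x \<noteq> \<xi>0 \<longrightarrow> d \<le> dist \<xi>0 x"
      using finite_set_avoid[OF insert(1), of \<xi>0] by blast
    then have "d \<le> cmod (\<xi> - \<xi>0)" if "\<xi> \<in> E" for \<xi>
      using insert(2) that by (metis dist_norm dist_commute)
    then have "2 * min 1 (d / 2) \<le> cmod (\<xi> - \<xi>0)" if "\<xi> \<in> E" for \<xi>
      using that by fastforce
    then show ?thesis
      using \<open>d > 0\<close> that[of "min 1 (d / 2)"] by simp
  qed
  show ?case
  proof (rule exI[of _ "min (c * m) (m ^ card E)"], intro conjI allI impI)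
    show "0 < min (c * m) (m ^ card E)" using c m(1) by simp
    fix w d
    assume d: "0 \<le> d" "d \<le> 1" and far: "\<forall>\<xi>\<in>insert \<xi>0 E. d \<le> cmod (\<xi> - w)"
    show "min (c * m) (m ^ card E) * d \<le> (\<Prod>\<xi>\<in>insert \<xi>0 E. cmod (\<xi> - w))"
    proof (cases "m \<le> cmod (\<xi>0 - w)")
      case True
      have "min (c * m) (m ^ card E) * d \<le> (c * m) * d"
        using d(1) by (intro mult_right_mono) auto
      also have "\<dots> = m * (c * d)" by simp
      also have "\<dots> \<le> cmod (\<xi>0 - w) * (\<Prod>\<xi>\<in>E. cmod (\<xi> - w))"
        using True cd[of d w] d c m(1) far by (intro mult_mono) auto
      finally show ?thesis using insert by simp
    next
      case False
      have "m \<le> cmod (\<xi> - w)" if "\<xi> \<in> E" for \<xi>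
        using m(3)[OF that] False norm_triangle_ineq4[of "\<xi> - w" "\<xi>0 - w"] by simp
      then have "m ^ card E \<le> (\<Prod>\<xi>\<in>E. cmod (\<xi> - w))"
        unfolding prod_constant[symmetric] using m(1) by (intro prod_mono) auto
      then have "m ^ card E * d \<le> (\<Prod>\<xi>\<in>E. cmod (\<xi> - w)) * cmod (\<xi>0 - w)"
        using d far m(1) by (intro mult_mono) (auto intro: prod_nonneg)
      moreover have "min (c * m) (m ^ card E) * d \<le> m ^ card E * d"
        using d by (intro mult_right_mono) auto
      ultimately show ?thesis using insert by (simp add: mult.commute)
    qed
  qed
qed

section \<open>Atoms on a Whitney decomposition of a contour\<close>

text \<open>\<open>W\<close> is the inner domain, \<open>U\<close> the outer one, and \<omega> the
  oriented derivative of the piece \<gamma>. On a leg \<open>x\<close> is comparable to the distance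
  from the corner, which is approached as \<open>x\<close> tends to 0.
  \<open>\<gamma>_inside\<close> bounds the weight from below on the contour, and
  \<open>\<gamma>_corner\<close> bounds it from above at \<open>z\<close> by the distance to the
  contour. By \<open>ratio\<close>, the image of the \<open>k\<close>-th cell stays within
  \<open>radius k\<close> of its node, while \<open>W\<close> is at least twice as far away.\<close>

locale whitney_contour =
  fixes E :: "complex set" and W U :: "complex set" and P :: "'p set"
    and \<gamma> \<omega> :: "'p \<Rightarrow> real \<Rightarrow> complex" and \<delta> \<kappa> L B \<rho> :: real
  assumes finite_E: "finite E" and E_sphere: "E \<subseteq> sphere 0 1"
    and finite_P: "finite P"
    and W_U: "W \<subseteq> U" and U_ball: "U \<subseteq> ball 0 1"
    and pos: "0 < \<delta>" "0 < \<kappa>" "\<kappa> \<le> 1" "0 < L" "0 < B" "0 < \<rho>" "\<rho> < 1"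
    and ratio: "L * (1 - \<rho> ^ 4) \<le> \<delta> / 2"
    and \<gamma>_U: "\<And>p x. p \<in> P \<Longrightarrow> 0 < x \<Longrightarrow> x \<le> 1 \<Longrightarrow> \<gamma> p x \<in> U"
    and \<gamma>_inside: "\<And>p x. p \<in> P \<Longrightarrow> 0 < x \<Longrightarrow> x \<le> 1 \<Longrightarrow> \<kappa> * x \<le> 1 - cmod (\<gamma> p x)"
    and \<gamma>_far: "\<And>p x z. p \<in> P \<Longrightarrow> 0 < x \<Longrightarrow> x \<le> 1 \<Longrightarrow> z \<in> W \<Longrightarrow> \<delta> * x \<le> cmod (z - \<gamma> p x)"
    and \<gamma>_corner: "\<And>p x z. p \<in> P \<Longrightarrow> 0 < x \<Longrightarrow> x \<le> 1 \<Longrightarrow> z \<in> W \<Longrightarrow>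
      (\<Prod>\<xi>\<in>E. cmod (\<xi> - z)) \<le> B * cmod (z - \<gamma> p x)"
    and \<gamma>_Lipschitz: "\<And>p x y. p \<in> P \<Longrightarrow> 0 < x \<Longrightarrow> x \<le> 1 \<Longrightarrow> 0 < y \<Longrightarrow> y \<le> 1 \<Longrightarrow>
      cmod (\<gamma> p x - \<gamma> p y) \<le> L * \<bar>x - y\<bar>"
    and \<omega>_cont: "\<And>p. p \<in> P \<Longrightarrow> continuous_on {0<..1} (\<omega> p)"
    and \<omega>_bound: "\<And>p x. p \<in> P \<Longrightarrow> 0 < x \<Longrightarrow> x \<le> 1 \<Longrightarrow> cmod (\<omega> p x) \<le> L"
begin

abbreviation "g \<equiv> corner_weight E"

definition node :: "'p \<Rightarrow> nat \<Rightarrow> complex" where "node p k = \<gamma> p (\<rho> ^ (4 * k))"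

definition radius :: "nat \<Rightarrow> real" where "radius k = \<delta> / 2 * \<rho> ^ (4 * k)"

definition cell :: "nat \<Rightarrow> real set" where "cell k = {\<rho> ^ (4 * Suc k) .. \<rho> ^ (4 * k)}"

text \<open>The \<open>z\<close>-part of the \<open>l\<close>-th term of \<open>1 / (w - z) = -
  (\<Sum>l. (w - node p k) ^ l / (z - node p k) ^ Suc l)\<close>, multiplied by \<open>g z\<close>;
  \<open>density\<close> carries the \<open>w\<close>-part and the sign. The factors
  \<open>\<rho> ^ (2 * k)\<close>, the order of the smallest possible weight on the cell, and
  \<open>radius k ^ Suc l\<close> are moved between the two so that the coefficients come out
  bounded in \<open>k\<close> and \<open>l\<close>.\<close>

definition atom :: "nat \<Rightarrow> 'p \<Rightarrow> nat \<Rightarrow> complex \<Rightarrow> complex"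
  where "atom k p l z = g z / of_real (\<rho> ^ (2 * k)) * (of_real (radius k) / (z - node p k)) ^ Suc l"

definition density :: "nat \<Rightarrow> 'p \<Rightarrow> nat \<Rightarrow> real \<Rightarrow> complex"
  where "density k p l x = - (of_real (\<rho> ^ (2 * k)) * \<omega> p x * (\<gamma> p x - node p k) ^ l) /
    (2 * of_real pi * \<i> * g (\<gamma> p x) * of_real (radius k) ^ Suc l)"

definition coefficient :: "nat \<Rightarrow> 'p \<Rightarrow> nat \<Rightarrow> (complex \<Rightarrow> 'z::complex_banach) \<Rightarrow> 'z"
  where "coefficient k p l h = integral (cell k) (\<lambda>x. density k p l x *\<^sub>C h (\<gamma> p x))"

lemma cell_bounds:
  assumes "x \<in> cell k"
  shows "0 < x" "x \<le> 1" "\<rho> ^ (4 * Suc k) \<le> x" "x \<le> \<rho> ^ (4 * k)"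
proof -
  have "\<rho> ^ (4 * Suc k) > 0" "\<rho> ^ (4 * k) \<le> 1" using pos by (auto intro: power_le_one)
  then show "0 < x" "x \<le> 1" "\<rho> ^ (4 * Suc k) \<le> x" "x \<le> \<rho> ^ (4 * k)"
    using assms unfolding cell_def by auto
qed

lemma cell_le: "\<rho> ^ (4 * Suc k) \<le> \<rho> ^ (4 * k)"
  using pos by (intro power_decreasing) auto

lemma scale_bounds: "0 < \<rho> ^ (4 * k)" "\<rho> ^ (4 * k) \<le> 1"
  using pos by (auto intro: power_le_one)

lemma radius_pos: "radius k > 0"
  using pos by (simp add: radius_def)

lemma g_nonzero: "z \<in> U \<Longrightarrow> g z \<noteq> 0"
  using corner_weight_nonzero[OF finite_E E_sphere] U_ball by blast

lemma continuous_on_g: "continuous_on U g"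
  by (meson holomorphic_on_imp_continuous_on holomorphic_on_subset holomorphic_corner_weight
      E_sphere U_ball)

lemma continuous_on_\<gamma>: "p \<in> P \<Longrightarrow> continuous_on {0<..1} (\<gamma> p)"
  by (rule lipschitz_on_continuous_on[of L])
    (use pos \<gamma>_Lipschitz in \<open>auto simp: lipschitz_on_def dist_norm\<close>)

lemma cell_subset: "cell k \<subseteq> {0<..1}"
  using cell_bounds by auto

lemma near_node:
  assumes "p \<in> P" "x \<in> cell k"
  shows "cmod (\<gamma> p x - node p k) \<le> radius k"
proof -
  have "cmod (\<gamma> p x - node p k) \<le> L * \<bar>x - \<rho> ^ (4 * k)\<bar>"
    unfolding node_def using cell_bounds[OF assms(2)] scale_bounds by (intro \<gamma>_Lipschitz assms) auto
  also have "\<dots> \<le> L * (\<rho> ^ (4 * k) - \<rho> ^ (4 * Suc k))"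
    using cell_bounds[OF assms(2)] pos by (intro mult_left_mono) auto
  also have "\<dots> = (L * (1 - \<rho> ^ 4)) * \<rho> ^ (4 * k)"
    by (simp add: power_add algebra_simps)
  also have "\<dots> \<le> \<delta> / 2 * \<rho> ^ (4 * k)"
    using ratio pos by (intro mult_right_mono) auto
  finally show ?thesis by (simp add: radius_def)
qed

lemma far_node:
  assumes "p \<in> P" "z \<in> W"
  shows "2 * radius k \<le> cmod (z - node p k)" "(cmod (g z))\<^sup>2 \<le> B * cmod (z - node p k)"
  using \<gamma>_far[OF assms(1) scale_bounds assms(2)] \<gamma>_corner[OF assms(1) scale_bounds assms(2)]
  by (auto simp: node_def radius_def norm_corner_weight_sq[OF E_sphere])

lemma node_ne: "p \<in> P \<Longrightarrow> z \<in> W \<Longrightarrow> z \<noteq> node p k"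
  using far_node(1)[of p z k] radius_pos[of k] by auto

lemma norm_quotient_le:
  assumes "p \<in> P" "z \<in> W"
  shows "cmod (of_real (radius k) / (z - node p k)) \<le> 1 / 2"
    "(cmod (g z))\<^sup>2 * cmod (of_real (radius k) / (z - node p k)) \<le> B * radius k"
proof -
  have d: "cmod (z - node p k) > 0" using node_ne[OF assms] by auto
  show "cmod (of_real (radius k) / (z - node p k)) \<le> 1 / 2"
    using far_node(1)[OF assms, of k] d radius_pos[of k] by (simp add: norm_divide divide_le_eq)
  show "(cmod (g z))\<^sup>2 * cmod (of_real (radius k) / (z - node p k)) \<le> B * radius k"
    using mult_right_mono[OF far_node(2)[OF assms, of k], of "radius k"] d radius_pos[of k]
    by (simp add: norm_divide divide_le_eq mult_ac)
qed

definition "atom_const = max 1 (\<delta> * B / 2)"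

lemma atom_const_ge: "atom_const \<ge> 1"
  by (simp add: atom_const_def)

text \<open>One factor of the power \<open>Suc l\<close> is spent on the minimum: bounded by 1/2 it
  gives the first alternative, and bounded by \<open>B * radius k / (cmod (g z))\<^sup>2\<close> the
  second, as \<open>radius k\<close> is \<open>\<delta> / 2\<close> times the square of
  \<open>\<rho> ^ (2 * k)\<close>. The other \<open>l\<close> factors give
  \<open>(1 / 2) ^ l\<close>. The two entries of \<open>atom_const\<close> belong to these two
  cases.\<close>

lemma norm_atom_le:
  assumes "p \<in> P" "z \<in> W"
  shows "cmod (atom k p l z) \<le>
    atom_const * (1 / 2) ^ l * min (cmod (g z) / \<rho> ^ (2 * k)) (\<rho> ^ (2 * k) / cmod (g z))"
proof -
  define G where "G = cmod (g z)"
  define q where "q = cmod (of_real (radius k) / (z - node p k))"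
  define t where "t = \<rho> ^ (2 * k)"
  have G: "G > 0" unfolding G_def using g_nonzero assms W_U by auto
  have t: "t > 0" unfolding t_def using pos by simp
  have q: "0 \<le> q" "q \<le> 1 / 2" and Gq: "G\<^sup>2 * q \<le> B * radius k"
    unfolding q_def G_def using norm_quotient_le[OF assms] by auto
  have "radius k = \<delta> / 2 * t\<^sup>2"
    unfolding radius_def t_def by (simp flip: power_mult)
  with Gq have Gq': "G\<^sup>2 * q \<le> (\<delta> * B / 2) * t\<^sup>2" by (simp add: mult_ac)
  have "G / t * q \<le> atom_const * (G / t)"
  proof -
    have "q \<le> atom_const" using q atom_const_ge by linarith
    then show ?thesis using G t by (simp add: divide_right_mono mult_left_mono mult.commute)
  qed
  moreover have "G / t * q \<le> atom_const * (t / G)"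
  proof -
    have "G\<^sup>2 * q \<le> atom_const * t\<^sup>2"
      using Gq' by (rule order_trans) (unfold atom_const_def, intro mult_right_mono max.cobounded2, simp)
    then show ?thesis
      using G t by (simp add: field_simps power2_eq_square)
  qed
  ultimately have "G / t * q \<le> atom_const * min (G / t) (t / G)"
    by (simp add: min_def)
  moreover have "q ^ l \<le> (1 / 2) ^ l"
    using q by (intro power_mono) auto
  ultimately have "(G / t * q) * q ^ l \<le> (atom_const * min (G / t) (t / G)) * (1 / 2) ^ l"
    by (rule mult_mono') (use G t q in auto)
  moreover have "cmod (atom k p l z) = (G / t * q) * q ^ l"
    unfolding atom_def G_def t_def q_def using pos
    by (simp add: norm_mult norm_divide norm_power)
  ultimately show ?thesis
    by (simp add: G_def t_def mult_ac)
qed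

lemma sqrt_norm_atom_le:
  assumes "p \<in> P" "z \<in> W"
  shows "sqrt (cmod (atom k p l z)) \<le>
    sqrt atom_const * sqrt (1 / 2) ^ l * min (sqrt (cmod (g z)) / \<rho> ^ k) (\<rho> ^ k / sqrt (cmod (g z)))"
proof -
  have "sqrt (min a b) = min (sqrt a) (sqrt b)" for a b by (simp add: min_def)
  moreover have "sqrt (\<rho> ^ (2 * k)) = \<rho> ^ k" using pos by (simp add: power_mult real_sqrt_power)
  ultimately show ?thesis
    using real_sqrt_le_mono[OF norm_atom_le[OF assms, of k l]]
    by (simp add: real_sqrt_mult real_sqrt_divide real_sqrt_power)
qed

definition "sum_const = real (card P) * (sqrt atom_const * (2 / (1 - \<rho>)) * (1 / (1 - sqrt (1 / 2))))"

lemma sum_sqrt_norm_atom_le: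
  assumes "finite F" "F \<subseteq> (UNIV \<times> P) \<times> UNIV" "z \<in> W"
  shows "(\<Sum>((k, p), l)\<in>F. sqrt (cmod (atom k p l z))) \<le> sum_const"
proof -
  define m where "m k = min (sqrt (cmod (g z)) / \<rho> ^ k) (\<rho> ^ k / sqrt (cmod (g z)))" for k
  obtain n where "(fst \<circ> fst) ` F \<union> snd ` F \<subseteq> {..<n}"
    using assms(1) by (metis finite_Un finite_imageI finite_nat_iff_bounded)
  then have F: "F \<subseteq> ({..<n} \<times> P) \<times> {..<n}"
    using assms(2) by force
  have mpos: "m k \<ge> 0" for k using pos by (simp add: m_def)
  have half: "sqrt (1 / 2) < (1 :: real)" by simp
  have "(\<Sum>((k, p), l)\<in>F. sqrt (cmod (atom k p l z))) \<le>
      (\<Sum>((k, p), l)\<in>({..<n} \<times> P) \<times> {..<n}. sqrt (cmod (atom k p l z)))"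
    using F finite_P by (intro sum_mono2) auto
  also have "\<dots> = (\<Sum>k<n. \<Sum>p\<in>P. \<Sum>l<n. sqrt (cmod (atom k p l z)))"
    by (simp add: sum.cartesian_product')
  also have "\<dots> \<le> (\<Sum>k<n. \<Sum>p\<in>P. \<Sum>l<n. sqrt atom_const * sqrt (1 / 2) ^ l * m k)"
    unfolding m_def using assms(3) by (intro sum_mono sqrt_norm_atom_le) auto
  also have "\<dots> = real (card P) * (sqrt atom_const * (\<Sum>k<n. m k) * (\<Sum>l<n. sqrt (1 / 2) ^ l))"
    by (simp add: sum_distrib_left sum_distrib_right mult_ac)
  also have "\<dots> \<le> sum_const"
    unfolding sum_const_def
  proof (intro mult_left_mono mult_mono)
    show "(\<Sum>k<n. m k) \<le> 2 / (1 - \<rho>)"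
      unfolding m_def using pos g_nonzero assms(3) W_U
      by (intro sum_two_sided_geometric_le) auto
    show "(\<Sum>l<n. sqrt (1 / 2) ^ l) \<le> 1 / (1 - sqrt (1 / 2 :: real))"
      using half by (simp add: sum_gp_strict divide_right_mono del: real_sqrt_divide)
  qed (use pos atom_const_ge half mpos in \<open>auto intro!: sum_nonneg\<close>)
  finally show ?thesis .
qed

text \<open>Since \<open>min a (1 / a) \<le> 1\<close>, every atom is at most
  \<open>atom_const\<close>, hence at most \<open>sqrt atom_const\<close> times its own square root;
  the bound for sums of square roots therefore controls the atoms themselves.\<close>

lemma atom_summable:
  assumes "z \<in> W"
  shows "(\<lambda>((k, p), l). cmod (atom k p l z)) summable_on (UNIV \<times> P) \<times> UNIV"
proof -
  let ?I = "((UNIV :: nat set) \<times> P) \<times> (UNIV :: nat set)"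
  have "(\<lambda>((k, p), l). sqrt (cmod (atom k p l z))) summable_on ?I"
    by (rule nonneg_bdd_above_summable_on)
      (auto intro!: bdd_aboveI2[where M = sum_const] sum_sqrt_norm_atom_le assms)
  then have sm: "(\<lambda>i. sqrt atom_const * (\<lambda>((k, p), l). sqrt (cmod (atom k p l z))) i) summable_on ?I"
    by (rule summable_on_cmult_right)
  have "cmod (atom k p l z) \<le> sqrt atom_const * sqrt (cmod (atom k p l z))" if "p \<in> P" for k p l
  proof -
    let ?a = "cmod (g z) / \<rho> ^ (2 * k)" and ?b = "\<rho> ^ (2 * k) / cmod (g z)"
    have "?b = 1 / ?a" by simp
    moreover have "min a (1 / a) \<le> 1" for a :: real
      by (cases "1 < a") (auto simp: min_le_iff_disj)
    ultimately have "min ?a ?b \<le> 1" by metis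
    moreover have "0 \<le> min ?a ?b" using pos by simp
    ultimately have "atom_const * (1 / 2) ^ l * min ?a ?b \<le> atom_const * 1 * 1"
      using atom_const_ge by (intro mult_mono power_le_one) auto
    then have "cmod (atom k p l z) \<le> atom_const"
      using norm_atom_le[OF that assms, of k l] by simp
    then have "sqrt (cmod (atom k p l z)) * sqrt (cmod (atom k p l z)) \<le>
        sqrt atom_const * sqrt (cmod (atom k p l z))"
      by (intro mult_right_mono) auto
    then show ?thesis by simp
  qed
  with Infinite_Sum.abs_summable_on_comparison_test'[OF sm, of "\<lambda>((k, p), l). cmod (atom k p l z)"]
  show ?thesis by (auto simp: case_prod_unfold)
qed

section \<open>Densities, coefficients and the scalar expansion\<close>

lemma density_cont:
  assumes "p \<in> P"
  shows "continuous_on (cell k) (density k p l)"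
proof -
  have "continuous_on (cell k) (\<lambda>x. g (\<gamma> p x))"
    by (rule continuous_on_compose2[OF continuous_on_g continuous_on_subset[OF continuous_on_\<gamma>[OF assms] cell_subset]])
      (use cell_bounds \<gamma>_U assms in blast)
  then show ?thesis
    unfolding density_def[abs_def]
    using continuous_on_subset[OF continuous_on_\<gamma>[OF assms] cell_subset]
      continuous_on_subset[OF \<omega>_cont[OF assms] cell_subset] g_nonzero \<gamma>_U[OF assms] cell_bounds radius_pos
    by (intro continuous_intros) (auto simp: less_imp_neq[THEN not_sym])
qed

text \<open>On cell \<open>k\<close> the weight is at least of order \<open>sqrt x\<close>, that is
  \<open>\<rho> ^ (2 * k)\<close>, and cancels the same factor in the numerator;
  \<open>near_node\<close> cancels \<open>l\<close> powers of the radius. One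
  \<open>radius k\<close> remains in the denominator, and it is of the order of the cell length, so
  that integrating over the cell gives a bound free of \<open>k\<close> and
  \<open>l\<close>.\<close>

lemma density_bound:
  "\<exists>C>0. \<forall>k l. \<forall>p\<in>P. \<forall>x\<in>cell k. cmod (density k p l x) * \<rho> ^ (4 * k) \<le> C"
proof -
  obtain c where c: "c > 0" and
    cd: "\<And>w d. 0 \<le> d \<Longrightarrow> d \<le> 1 \<Longrightarrow> (\<forall>\<xi>\<in>E. d \<le> cmod (\<xi> - w)) \<Longrightarrow> c * d \<le> (\<Prod>\<xi>\<in>E. cmod (\<xi> - w))"
    using prod_dist_lower_bound[OF finite_E] by blast
  define C where "C = L / (sqrt (c * \<kappa>) * \<rho>\<^sup>2) * (2 / \<delta>)"
  have "cmod (density k p l x) * \<rho> ^ (4 * k) \<le> C" if p: "p \<in> P" and x: "x \<in> cell k" for k l p x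
  proof -
    note xb = cell_bounds[OF x]
    define t where "t = \<rho> ^ (2 * k)"
    have t: "t > 0" "\<rho> ^ (4 * k) = t\<^sup>2" using pos by (simp_all add: t_def flip: power_mult)
    have R: "radius k > 0" "radius k = \<delta> / 2 * t\<^sup>2"
      by (rule radius_pos, simp add: radius_def t)
    have in': "\<kappa> * x \<le> 1 - cmod (\<gamma> p x)" by (rule \<gamma>_inside) (use p xb in auto)
    have "\<kappa> * x \<le> cmod (\<xi> - \<gamma> p x)" if "\<xi> \<in> E" for \<xi>
      using norm_triangle_ineq2[of \<xi> "\<gamma> p x"] that E_sphere in' by auto
    moreover have "0 \<le> \<kappa> * x" using pos xb by simp
    moreover have "\<kappa> * x \<le> 1" using in' norm_ge_zero[of "\<gamma> p x"] by linarith
    ultimately have "c * (\<kappa> * x) \<le> (cmod (g (\<gamma> p x)))\<^sup>2"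
      unfolding norm_corner_weight_sq[OF E_sphere] by (intro cd) auto
    moreover have "c * \<kappa> * (\<rho>\<^sup>2 * t)\<^sup>2 \<le> c * (\<kappa> * x)"
    proof -
      have "(\<rho>\<^sup>2 * t)\<^sup>2 \<le> x"
        using xb(3) t by (simp add: power_mult_distrib power_add flip: power_mult)
      then show ?thesis using c pos by (simp add: mult_left_mono)
    qed
    ultimately have "sqrt (c * \<kappa> * (\<rho>\<^sup>2 * t)\<^sup>2) \<le> sqrt ((cmod (g (\<gamma> p x)))\<^sup>2)"
      by (intro real_sqrt_le_mono) linarith
    then have g_low: "sqrt (c * \<kappa>) * (\<rho>\<^sup>2 * t) \<le> cmod (g (\<gamma> p x))"
      using pos t by (simp add: real_sqrt_mult)
    have low_pos: "0 < sqrt (c * \<kappa>) * (\<rho>\<^sup>2 * t)" using c pos t by simp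
    have "cmod (density k p l x) = t * cmod (\<omega> p x) * cmod (\<gamma> p x - node p k) ^ l /
        (2 * pi * cmod (g (\<gamma> p x)) * radius k ^ Suc l)"
      using t(1) R(1) by (simp add: density_def norm_divide norm_mult norm_power t_def[symmetric])
    also have "\<dots> \<le> t * L * radius k ^ l / (1 * (sqrt (c * \<kappa>) * (\<rho>\<^sup>2 * t)) * radius k ^ Suc l)"
    proof (intro frac_le mult_mono power_mono)
      show "1 \<le> 2 * pi" using pi_ge_two by linarith
    qed (use t R(1) pos low_pos g_low near_node[OF p x] \<omega>_bound[OF p xb(1,2)] in auto)
    also have "\<dots> = L / (sqrt (c * \<kappa>) * \<rho>\<^sup>2) * (2 / \<delta>) / t\<^sup>2"
    proof -
      have "radius k ^ Suc l = radius k ^ l * (\<delta> / 2 * t\<^sup>2)" using R(2) by simp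
      then show ?thesis using t R(1) pos c by (simp add: field_simps)
    qed
    finally have "cmod (density k p l x) \<le> C / t\<^sup>2"
      unfolding C_def .
    then show ?thesis using t by (simp add: pos_le_divide_eq)
  qed
  moreover have "C > 0" unfolding C_def using pos c by simp
  ultimately show ?thesis by blast
qed

end

lemma vholomorphic_on_imp_continuous_on:
  "f vholomorphic_on S \<Longrightarrow> continuous_on S f"
  by (metis vholomorphic_on_def has_derivative_continuous continuous_on_eq_continuous_within)

lemma norm_le_H_inf_norm:
  assumes "h \<in> H_inf U" "z \<in> U"
  shows "norm (h z) \<le> H_inf_norm U h"
proof -
  have "bdd_above ((\<lambda>z. norm (h z)) ` U)"
    using assms(1) bounded_norm_comp[of h U] bounded_imp_bdd_above by (auto simp: H_inf_def)
  then show ?thesis unfolding H_inf_norm_def using assms(2) by (rule cSUP_upper2) auto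
qed

context whitney_contour
begin

lemma continuous_on_compose_\<gamma>:
  assumes "p \<in> P" "continuous_on U h"
  shows "continuous_on (cell k) (\<lambda>x. h (\<gamma> p x))"
  by (rule continuous_on_compose2[OF assms(2) continuous_on_subset[OF continuous_on_\<gamma>[OF assms(1)] cell_subset]])
    (use cell_bounds \<gamma>_U assms in blast)

lemma coefficient_integrand_cont:
  assumes "p \<in> P" "h vholomorphic_on U"
  shows "continuous_on (cell k) (\<lambda>x. density k p l x *\<^sub>C h (\<gamma> p x))"
  by (intro bounded_bilinear.continuous_on[OF bounded_bilinear_scaleC] density_cont
      continuous_on_compose_\<gamma> vholomorphic_on_imp_continuous_on assms)

lemma coefficient_bound:
  "\<exists>C>0. \<forall>h :: complex \<Rightarrow> 'z::complex_banach. h \<in> H_inf U \<longrightarrow>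
    (\<forall>k l. \<forall>p\<in>P. norm (coefficient k p l h) \<le> C * H_inf_norm U h)"
proof -
  obtain C where C: "C > 0"
    and bd: "\<And>k l p x. p \<in> P \<Longrightarrow> x \<in> cell k \<Longrightarrow> cmod (density k p l x) * \<rho> ^ (4 * k) \<le> C"
    using density_bound by blast
  have "norm (coefficient k p l h) \<le> C * H_inf_norm U h"
    if h: "h \<in> H_inf U" and p: "p \<in> P" for h :: "complex \<Rightarrow> 'z" and k l p
  proof -
    define H where "H = H_inf_norm U h"
    have "norm (h (\<gamma> p 1)) \<le> H"
      unfolding H_def using \<gamma>_U[OF p, of 1] h by (intro norm_le_H_inf_norm) auto
    then have H: "H \<ge> 0" using norm_ge_zero order_trans by blast
    have "norm (coefficient k p l h) \<le> C / \<rho> ^ (4 * k) * H * (\<rho> ^ (4 * k) - \<rho> ^ (4 * Suc k))"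
      unfolding coefficient_def cell_def
    proof (rule integral_bound[OF cell_le])
      show "continuous_on {\<rho> ^ (4 * Suc k)..\<rho> ^ (4 * k)} (\<lambda>x. density k p l x *\<^sub>C h (\<gamma> p x))"
        using coefficient_integrand_cont[OF p, of h k l] h by (simp add: H_inf_def cell_def)
      fix x assume "x \<in> {\<rho> ^ (4 * Suc k)..\<rho> ^ (4 * k)}"
      then have x: "x \<in> cell k" by (simp add: cell_def)
      have "norm (h (\<gamma> p x)) \<le> H"
        unfolding H_def using \<gamma>_U[OF p] cell_bounds[OF x] h by (intro norm_le_H_inf_norm) auto
      moreover have "cmod (density k p l x) \<le> C / \<rho> ^ (4 * k)"
        using bd[OF p x] scale_bounds by (simp add: pos_le_divide_eq)
      ultimately show "norm (density k p l x *\<^sub>C h (\<gamma> p x)) \<le> C / \<rho> ^ (4 * k) * H"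
        unfolding norm_scaleC using C scale_bounds[of k] by (intro mult_mono) auto
    qed
    also have "\<dots> \<le> C / \<rho> ^ (4 * k) * H * \<rho> ^ (4 * k)"
      using C H scale_bounds[of k] scale_bounds[of "Suc k"] by (intro mult_left_mono) auto
    also have "\<dots> = C * H" using pos by simp
    finally show ?thesis unfolding H_def .
  qed
  then show ?thesis using C by blast
qed

lemma coefficient_linear:
  assumes "p \<in> P" "h vholomorphic_on U" "bounded_linear \<phi>" "\<And>a x. \<phi> (a *\<^sub>C x) = a * \<phi> x"
  shows "\<phi> (coefficient k p l h) = integral (cell k) (\<lambda>x. density k p l x * \<phi> (h (\<gamma> p x)))"
proof -
  have "(\<lambda>x. density k p l x *\<^sub>C h (\<gamma> p x)) integrable_on cell k"
    using coefficient_integrand_cont[OF assms(1,2)] unfolding cell_def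
    by (intro integrable_continuous_real)
  from integral_linear[OF this assms(3)] show ?thesis
    by (simp add: coefficient_def o_def assms(4))
qed

lemma \<gamma>_ne:
  assumes "p \<in> P" "0 < x" "x \<le> 1" "z \<in> W"
  shows "\<gamma> p x \<noteq> z"
proof -
  have "0 < \<delta> * x" using pos assms by simp
  then show ?thesis using \<gamma>_far[OF assms] by auto
qed

text \<open>No series is integrated term by term:
  \<open>(\<Sum>l<n. v ^ l) * (1 - v) = 1 - v ^ n\<close> makes each partial sum equal to the full
  integral minus a remainder, and the remainder is \<open>O((1 / 2) ^ n)\<close> because
  \<open>?B\<close> is bounded on the compact cell.\<close>

lemma cell_expansion:
  assumes p: "p \<in> P" and z: "z \<in> W" and F: "continuous_on (cell k) F"
  shows "(\<lambda>l. atom k p l z * integral (cell k) (\<lambda>x. density k p l x * F x)) sums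
    (g z / (2 * of_real pi * \<i>) * integral (cell k) (\<lambda>x. F x / g (\<gamma> p x) * \<omega> p x / (\<gamma> p x - z)))"
    (is "?f sums (?K * integral _ ?B)")
proof -
  define v where "v x = (\<gamma> p x - node p k) / (z - node p k)" for x
  have d: "z - node p k \<noteq> 0" using node_ne[OF p z] by simp
  have \<gamma>z: "\<gamma> p x \<noteq> z" if "x \<in> cell k" for x
    by (rule \<gamma>_ne[OF p cell_bounds(1,2)[OF that] z])
  have v: "cmod (v x) \<le> 1 / 2" if "x \<in> cell k" for x
  proof -
    have "cmod (\<gamma> p x - node p k) * 2 \<le> cmod (z - node p k)"
      using near_node[OF p that] far_node(1)[OF p z, of k] by linarith
    then show ?thesis using d by (simp add: v_def norm_divide divide_le_eq)
  qed
  have \<gamma>c: "continuous_on (cell k) (\<gamma> p)"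
    by (rule continuous_on_subset[OF continuous_on_\<gamma>[OF p] cell_subset])
  have \<omega>c: "continuous_on (cell k) (\<omega> p)"
    by (rule continuous_on_subset[OF \<omega>_cont[OF p] cell_subset])
  have vc: "continuous_on (cell k) v"
    unfolding v_def[abs_def] using d by (intro continuous_intros \<gamma>c) auto
  have Bc: "continuous_on (cell k) ?B"
    using \<gamma>z g_nonzero \<gamma>_U[OF p] cell_bounds
    by (intro continuous_intros F \<omega>c \<gamma>c continuous_on_compose_\<gamma> p continuous_on_g) auto
  have int: "G integrable_on cell k" if "continuous_on (cell k) G" for G :: "real \<Rightarrow> complex"
    using that unfolding cell_def by (rule integrable_continuous_real)
  have summand: "atom k p l z * (density k p l x * F x) = ?K * (?B x * (v x ^ l * (1 - v x)))"
    if x: "x \<in> cell k" for x l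
  proof -
    \<comment> \<open>The letters stand for \<open>G = g z\<close>,
      \<open>t = \<rho> ^ (2 * k)\<close>, \<open>R = radius k\<close>,
      \<open>d = z - node p k\<close>, \<open>e = \<gamma> p x - node p k\<close>,
      \<open>q = g (\<gamma> p x)\<close>, \<open>u = \<gamma> p x - z\<close>,
      \<open>w = \<omega> p x\<close>, \<open>c = 2 \<pi> \<i>\<close> and
      \<open>y = F x\<close>.\<close>
    have alg: "G / t * (R / d) ^ Suc l * (- (t * w * e ^ l) / (c * q * R ^ Suc l) * y) =
        G / c * (y / q * w / u * ((e / d) ^ l * (- u / d)))"
      if "t \<noteq> 0" "R \<noteq> 0" "d \<noteq> 0" "q \<noteq> 0" "u \<noteq> 0" "c \<noteq> 0" for G t R d w e c q y u :: complex
      using that by (simp add: power_divide mult_ac)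
    have "1 - v x = - (\<gamma> p x - z) / (z - node p k)"
      using d by (simp add: v_def field_simps)
    moreover have "g (\<gamma> p x) \<noteq> 0" using g_nonzero \<gamma>_U[OF p] cell_bounds[OF x] by auto
    moreover have "complex_of_real (\<rho> ^ (2 * k)) \<noteq> 0" "complex_of_real (radius k) \<noteq> 0"
      using pos radius_pos[of k] by auto
    ultimately show ?thesis
      unfolding atom_def density_def using d \<gamma>z[OF x] by (simp only: v_def) (rule alg, auto)
  qed
  have geo: "(\<Sum>l<n. v x ^ l) * (1 - v x) = 1 - v x ^ n" for n x
    by (simp add: one_diff_power_eq mult.commute)
  have partial: "(\<Sum>l<n. ?f l) = ?K * integral (cell k) ?B - ?K * integral (cell k) (\<lambda>x. ?B x * v x ^ n)" for n
  proof -
    have "(\<Sum>l<n. ?f l) = (\<Sum>l<n. integral (cell k) (\<lambda>x. ?K * (?B x * (v x ^ l * (1 - v x)))))"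
      unfolding integral_mult_right[symmetric] by (intro sum.cong refl integral_cong summand)
    also have "\<dots> = integral (cell k) (\<lambda>x. \<Sum>l<n. ?K * (?B x * (v x ^ l * (1 - v x))))"
      by (intro integral_sum[symmetric] int continuous_intros Bc vc) auto
    also have "\<dots> = integral (cell k) (\<lambda>x. ?K * (?B x - ?B x * v x ^ n))"
      unfolding sum_distrib_left[symmetric] sum_distrib_right[symmetric]
      by (intro integral_cong) (simp only: geo, simp only: right_diff_distrib mult_1_right)
    also have "\<dots> = ?K * (integral (cell k) ?B - integral (cell k) (\<lambda>x. ?B x * v x ^ n))"
      unfolding integral_mult_right
      by (subst integral_diff[OF int[OF Bc] int[OF continuous_on_mult[OF Bc continuous_on_power[OF vc]]]]) simp
    finally show ?thesis by (simp add: algebra_simps)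
  qed
  have "compact (?B ` cell k)"
    unfolding cell_def by (intro compact_continuous_image Bc[unfolded cell_def]) auto
  then obtain M where M: "\<And>x. x \<in> cell k \<Longrightarrow> cmod (?B x) \<le> M"
    by (meson bounded_iff compact_imp_bounded imageI)
  have "(\<lambda>n. integral (cell k) (\<lambda>x. ?B x * v x ^ n)) \<longlonglongrightarrow> 0"
  proof (rule Lim_null_comparison)
    show "\<forall>\<^sub>F n in sequentially. cmod (integral (cell k) (\<lambda>x. ?B x * v x ^ n)) \<le>
        M * (1 / 2) ^ n * (\<rho> ^ (4 * k) - \<rho> ^ (4 * Suc k))"
    proof (intro always_eventually allI)
      fix n
      show "cmod (integral (cell k) (\<lambda>x. ?B x * v x ^ n)) \<le>
          M * (1 / 2) ^ n * (\<rho> ^ (4 * k) - \<rho> ^ (4 * Suc k))"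
        unfolding cell_def
      proof (rule integral_bound[OF cell_le], fold cell_def)
        show "continuous_on (cell k) (\<lambda>x. ?B x * v x ^ n)"
          by (intro continuous_on_mult continuous_on_power Bc vc)
        fix x assume x: "x \<in> cell k"
        show "cmod (?B x * v x ^ n) \<le> M * (1 / 2) ^ n"
          unfolding norm_mult norm_power
          using M[OF x] v[OF x] order_trans[OF norm_ge_zero M[OF x]]
          by (intro mult_mono power_mono) auto
      qed
    qed
    have "(\<lambda>n. M * (1 / 2) ^ n * (\<rho> ^ (4 * k) - \<rho> ^ (4 * Suc k))) \<longlonglongrightarrow> M * 0 * (\<rho> ^ (4 * k) - \<rho> ^ (4 * Suc k))"
      by (intro tendsto_intros LIMSEQ_realpow_zero) auto
    then show "(\<lambda>n. M * (1 / 2) ^ n * (\<rho> ^ (4 * k) - \<rho> ^ (4 * Suc k))) \<longlonglongrightarrow> 0" by simp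
  qed
  then have "(\<lambda>n. \<Sum>l<n. ?f l) \<longlonglongrightarrow> ?K * integral (cell k) ?B - ?K * 0"
    unfolding partial by (intro tendsto_intros)
  then show ?thesis by (simp add: sums_def)
qed

lemma sum_cell_integral:
  assumes F: "continuous_on {0<..1} (F :: real \<Rightarrow> complex)"
  shows "(\<Sum>k<n. integral (cell k) F) = integral {\<rho> ^ (4 * n)..1} F"
proof (induction n)
  case (Suc n)
  have "integral {\<rho> ^ (4 * Suc n)..\<rho> ^ (4 * n)} F + integral {\<rho> ^ (4 * n)..1} F =
      integral {\<rho> ^ (4 * Suc n)..1} F"
    using scale_bounds[of "Suc n"] scale_bounds[of n]
    by (intro Henstock_Kurzweil_Integration.integral_combine cell_le integrable_continuous_real
        continuous_on_subset[OF F]) auto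
  then show ?case using Suc by (simp add: cell_def add.commute)
qed (simp add: integral_refl)

text \<open>Bounded coefficients make the triple sum absolutely convergent, so it may be evaluated
  in a convenient order: over \<open>l\<close> to recover cell integrals, over \<open>p\<close>, and
  finally over \<open>k\<close>, where the partial sums are integrals truncated at
  \<open>\<rho> ^ (4 * n)\<close> and the assumed Cauchy limit applies.\<close>

lemma scalar_expansion:
  assumes z: "z \<in> W" and f: "continuous_on U f"
    and bd: "\<And>k l p. p \<in> P \<Longrightarrow> cmod (integral (cell k) (\<lambda>x. density k p l x * f (\<gamma> p x))) \<le> M"
    and cauchy: "(\<lambda>n. \<Sum>p\<in>P. integral {\<rho> ^ (4 * n)..1} (\<lambda>x. f (\<gamma> p x) / g (\<gamma> p x) * \<omega> p x / (\<gamma> p x - z)))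
      \<longlonglongrightarrow> 2 * of_real pi * \<i> * (f z / g z)"
  shows "((\<lambda>((k, p), l). atom k p l z * integral (cell k) (\<lambda>x. density k p l x * f (\<gamma> p x)))
    has_sum f z) ((UNIV \<times> P) \<times> UNIV)"
proof -
  let ?I = "((UNIV :: nat set) \<times> P) \<times> (UNIV :: nat set)"
  let ?a = "\<lambda>k p l. integral (cell k) (\<lambda>x. density k p l x * f (\<gamma> p x))"
  let ?T = "\<lambda>((k, p), l). atom k p l z * ?a k p l"
  let ?B = "\<lambda>p x. f (\<gamma> p x) / g (\<gamma> p x) * \<omega> p x / (\<gamma> p x - z)"
  let ?K = "g z / (2 * of_real pi * \<i>)"
  have "(\<lambda>i. (\<lambda>((k, p), l). cmod (atom k p l z)) i * M) summable_on ?I"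
    by (rule summable_on_cmult_left[OF atom_summable[OF z]])
  then have abs: "(\<lambda>i. norm (?T i)) summable_on ?I"
    by (rule Infinite_Sum.abs_summable_on_comparison_test')
      (auto simp: norm_mult intro!: mult_left_mono bd)
  then obtain S where S: "(?T has_sum S) ?I"
    using abs_summable_summable summable_on_def by blast
  have "((\<lambda>l. ?T ((k, p), l)) has_sum (?K * integral (cell k) (?B p))) UNIV" if p: "p \<in> P" for k p
  proof (rule norm_summable_imp_has_sum)
    show "(\<lambda>l. ?T ((k, p), l)) sums (?K * integral (cell k) (?B p))"
      using cell_expansion[OF p z continuous_on_compose_\<gamma>[OF p f]] by simp
    have "(\<lambda>i. norm (?T i)) summable_on (Pair (k, p) ` UNIV)"
      by (rule summable_on_subset_banach[OF abs]) (use p in auto)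
    then have "(\<lambda>l. norm (?T ((k, p), l))) summable_on UNIV"
      by (subst (asm) summable_on_reindex) (auto simp: o_def inj_on_def)
    then show "summable (\<lambda>l. norm (?T ((k, p), l)))"
      by (rule summable_on_imp_summable)
  qed
  then have "((\<lambda>(k, p). ?K * integral (cell k) (?B p)) has_sum S) (UNIV \<times> P)"
    by (intro has_sum_SigmaD[OF S]) auto
  then have "((\<lambda>k. \<Sum>p\<in>P. ?K * integral (cell k) (?B p)) has_sum S) UNIV"
    by (rule has_sum_SigmaD) (use finite_P in \<open>auto intro!: has_sum_finite\<close>)
  then have "(\<lambda>n. \<Sum>k<n. \<Sum>p\<in>P. ?K * integral (cell k) (?B p)) \<longlonglongrightarrow> S"
    by (auto dest: has_sum_imp_sums simp: sums_def)
  moreover have "(\<Sum>k<n. \<Sum>p\<in>P. ?K * integral (cell k) (?B p)) =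
      ?K * (\<Sum>p\<in>P. integral {\<rho> ^ (4 * n)..1} (?B p))" for n
  proof -
    have "(\<Sum>k<n. integral (cell k) (?B p)) = integral {\<rho> ^ (4 * n)..1} (?B p)" if p: "p \<in> P" for p
    proof (rule sum_cell_integral)
      have c: "continuous_on {0<..1} (\<lambda>x. h (\<gamma> p x))" if "continuous_on U h" for h :: "complex \<Rightarrow> complex"
        by (rule continuous_on_compose2[OF that continuous_on_\<gamma>[OF p]]) (use \<gamma>_U[OF p] in auto)
      have "\<gamma> p x \<noteq> z" if "0 < x" "x \<le> 1" for x
        by (rule \<gamma>_ne[OF p that z])
      then show "continuous_on {0<..1} (?B p)"
        using g_nonzero \<gamma>_U[OF p]
        by (intro continuous_intros c f continuous_on_g \<omega>_cont continuous_on_\<gamma> p) auto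
    qed
    note cells = this
    have "(\<Sum>k<n. \<Sum>p\<in>P. ?K * integral (cell k) (?B p)) =
        (\<Sum>p\<in>P. ?K * (\<Sum>k<n. integral (cell k) (?B p)))"
      by (subst sum.swap) (simp only: sum_distrib_left)
    also have "\<dots> = (\<Sum>p\<in>P. ?K * integral {\<rho> ^ (4 * n)..1} (?B p))"
      by (intro sum.cong refl arg_cong[of _ _ "(*) ?K"] cells)
    finally show ?thesis by (simp only: sum_distrib_left)
  qed
  moreover have "(\<lambda>n. ?K * (\<Sum>p\<in>P. integral {\<rho> ^ (4 * n)..1} (?B p))) \<longlonglongrightarrow>
      ?K * (2 * of_real pi * \<i> * (f z / g z))"
    by (intro tendsto_intros cauchy)
  ultimately have "S = ?K * (2 * of_real pi * \<i> * (f z / g z))"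
    using LIMSEQ_unique by (metis (no_types, lifting) LIMSEQ_unique ext)
  also have "\<dots> = f z" using g_nonzero z W_U by auto
  finally show ?thesis using S by simp
qed

end

section \<open>Enumerated atoms and vector-valued functions\<close>

lemma bounded_linear_comp_holomorphic:
  assumes "h vholomorphic_on U" "bounded_linear \<phi>" "\<And>a x. \<phi> (a *\<^sub>C x) = a * \<phi> x"
  shows "(\<lambda>w. \<phi> (h w)) holomorphic_on U"
  unfolding holomorphic_on_def field_differentiable_def has_field_derivative_def
proof
  fix z assume "z \<in> U"
  then obtain D where "(h has_derivative (\<lambda>w. w *\<^sub>C D)) (at z within U)"
    using assms(1) unfolding vholomorphic_on_def by blast
  from bounded_linear.has_derivative[OF assms(2) this]
  have "((\<lambda>w. \<phi> (h w)) has_derivative (*) (\<phi> D)) (at z within U)"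
    by (rule has_derivative_eq_rhs) (simp add: fun_eq_iff assms(3) mult.commute)
  then show "\<exists>f'. ((\<lambda>w. \<phi> (h w)) has_derivative (*) f') (at z within U)" by blast
qed

context whitney_contour
begin

lemma holomorphic_atom:
  assumes "p \<in> P" shows "atom k p l holomorphic_on W"
proof -
  have "g holomorphic_on W"
    by (rule holomorphic_on_subset[OF holomorphic_corner_weight[OF E_sphere]]) (use W_U U_ball in auto)
  then show ?thesis
    unfolding atom_def[abs_def] using node_ne[OF assms] pos
    by (intro holomorphic_intros) auto
qed

text \<open>Here the constant may depend on \<open>k\<close>: the purpose is the decay of a single
  atom at the corners, as membership in \<open>H0_inf\<close> demands.\<close>

lemma norm_atom_le_weight:
  assumes "p \<in> P" "z \<in> W"
  shows "cmod (atom k p l z) \<le> 1 / \<rho> ^ (2 * k) * cmod (g z)"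
proof -
  have "cmod (of_real (radius k) / (z - node p k)) ^ Suc l \<le> 1"
    using norm_quotient_le(1)[OF assms, of k] by (intro power_le_one) auto
  then have "cmod (g z) / \<rho> ^ (2 * k) * cmod (of_real (radius k) / (z - node p k)) ^ Suc l \<le>
      cmod (g z) / \<rho> ^ (2 * k) * 1"
    using pos by (intro mult_left_mono) auto
  then show ?thesis
    using pos by (simp add: atom_def norm_mult norm_divide norm_power del: power_Suc)
qed

end

text \<open>Cauchy's formula is required as a limit along the cut points, the form in which sums
  over cells produce it. The piece type is countable so that the index triples can be enumerated by
  the natural numbers.\<close>

locale reproducing_contour = whitney_contour E W U P \<gamma> \<omega> \<delta> \<kappa> L B \<rho>
  for E W U and P :: "'p::countable set" and \<gamma> \<omega> \<delta> \<kappa> L B \<rho> +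
  assumes U_nonempty: "U \<noteq> {}"
    and cauchy: "\<And>f z. f holomorphic_on U \<Longrightarrow> bounded (f ` U) \<Longrightarrow> z \<in> W \<Longrightarrow>
    (\<lambda>n. \<Sum>p\<in>P. integral {\<rho> ^ (4 * n)..1}
      (\<lambda>x. f (\<gamma> p x) / corner_weight E (\<gamma> p x) * \<omega> p x / (\<gamma> p x - z)))
    \<longlonglongrightarrow> 2 * of_real pi * \<i> * (f z / corner_weight E z)"
begin

text \<open>Enumerates the whole index type, so that a bijection with the natural numbers exists
  whatever \<open>P\<close> is; indices outside \<open>P\<close> receive the zero function and the
  zero coefficient.\<close>

definition idx :: "nat \<Rightarrow> (nat \<times> 'p) \<times> nat" where "idx = from_nat_into UNIV"

definition \<Phi> :: "nat \<Rightarrow> complex \<Rightarrow> complex"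
  where "\<Phi> i z = (case idx i of ((k, p), l) \<Rightarrow> if p \<in> P then atom k p l z else 0)"

definition \<alpha> :: "(complex \<Rightarrow> 'z::complex_banach) \<Rightarrow> nat \<Rightarrow> 'z"
  where "\<alpha> h i = (case idx i of ((k, p), l) \<Rightarrow> if p \<in> P then coefficient k p l h else 0)"

lemma bij_idx: "bij_betw idx UNIV UNIV"
  unfolding idx_def by (rule bij_betw_from_nat_into) (auto simp: finite_prod)

lemma has_sum_idx:
  assumes "\<And>k p l. p \<notin> P \<Longrightarrow> F ((k, p), l) = 0"
  shows "((\<lambda>i. F (idx i)) has_sum S) UNIV \<longleftrightarrow> (F has_sum S) ((UNIV \<times> P) \<times> UNIV)"
  unfolding has_sum_reindex_bij_betw[OF bij_idx]
  by (rule has_sum_cong_neutral) (use assms in auto)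

lemma \<Phi>_holomorphic: "\<Phi> i holomorphic_on W"
proof -
  obtain k p l where "idx i = ((k, p), l)" by (metis prod.exhaust)
  then show ?thesis using holomorphic_atom by (cases "p \<in> P") (auto simp: \<Phi>_def[abs_def])
qed

lemma \<Phi>_le_weight: "\<exists>K>0. \<forall>z\<in>W. cmod (\<Phi> i z) \<le> K * cmod (g z)"
proof -
  obtain k p l where i: "idx i = ((k, p), l)" by (metis prod.exhaust)
  show ?thesis
    using norm_atom_le_weight[of p _ k l] pos
    by (intro exI[of _ "1 / \<rho> ^ (2 * k)"]) (auto simp: \<Phi>_def i)
qed

lemma sum_sqrt_\<Phi>_le:
  assumes "z \<in> W" shows "(\<Sum>i<n. sqrt (cmod (\<Phi> i z))) \<le> sum_const"
proof -
  let ?F = "{i \<in> idx ` {..<n}. i \<in> (UNIV \<times> P) \<times> UNIV}"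
  let ?a = "\<lambda>((k, p), l). if p \<in> P then sqrt (cmod (atom k p l z)) else 0"
  have "(\<Sum>i<n. sqrt (cmod (\<Phi> i z))) = (\<Sum>i<n. ?a (idx i))"
    by (intro sum.cong) (auto simp: \<Phi>_def split: prod.split)
  also have "\<dots> = sum ?a (idx ` {..<n})"
    using bij_idx by (subst sum.reindex) (auto simp: bij_betw_def inj_on_def)
  also have "\<dots> = sum ?a ?F"
    by (intro sum.mono_neutral_right) (auto split: if_splits)
  also have "\<dots> = (\<Sum>((k, p), l)\<in>?F. sqrt (cmod (atom k p l z)))"
    by (intro sum.cong) auto
  also have "\<dots> \<le> sum_const"
    using assms by (intro sum_sqrt_norm_atom_le) auto
  finally show ?thesis .
qed

lemma \<alpha>_bound:
  "\<exists>C>0. \<forall>h :: complex \<Rightarrow> 'z::complex_banach. h \<in> H_inf U \<longrightarrow> (\<forall>i. norm (\<alpha> h i) \<le> C * H_inf_norm U h)"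
proof -
  obtain C where C: "C > 0" and bd: "\<And>(h :: complex \<Rightarrow> 'z) k l p. h \<in> H_inf U \<Longrightarrow> p \<in> P \<Longrightarrow>
      norm (coefficient k p l h) \<le> C * H_inf_norm U h"
    using coefficient_bound by blast
  have "norm (\<alpha> h i) \<le> C * H_inf_norm U h" if h: "h \<in> H_inf U" for h :: "complex \<Rightarrow> 'z" and i
  proof -
    obtain k p l where i: "idx i = ((k, p), l)" by (metis prod.exhaust)
    show ?thesis
    proof (cases "p \<in> P")
      case True
      then show ?thesis using bd[OF h] by (simp add: \<alpha>_def i)
    next
      case False
      \<comment> \<open>The padding coefficient is 0, so the claim is nonnegativity of the supremum,
        which takes a point of \<open>U\<close>.\<close>
      have "0 \<le> C * H_inf_norm U h"
      proof -
        obtain w where "w \<in> U" using U_nonempty by blast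
        then have "0 \<le> H_inf_norm U h"
          using norm_le_H_inf_norm[OF h] order_trans[OF norm_ge_zero] by blast
        then show ?thesis using C by simp
      qed
      then show ?thesis using False by (simp add: \<alpha>_def i)
    qed
  qed
  then show ?thesis using C by blast
qed

text \<open>Absolute convergence in the Banach space provides some sum \<open>y\<close>. A
  functional separating \<open>y\<close> from \<open>h z\<close> would turn the series into the
  expansion of the scalar function \<open>\<phi> (h w)\<close>, whose sum at \<open>z\<close> is
  \<open>\<phi> (h z)\<close>; uniqueness of sums gives the contradiction.\<close>

lemma decomposition_sums:
  fixes h :: "complex \<Rightarrow> 'z::complex_banach"
  assumes h: "h \<in> H_inf U" and z: "z \<in> W"
  shows "(\<lambda>i. \<Phi> i z *\<^sub>C \<alpha> h i) sums h z"
proof -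
  obtain C where C: "\<And>k l p. p \<in> P \<Longrightarrow> norm (coefficient k p l h) \<le> C"
    using coefficient_bound h by blast
  let ?F = "\<lambda>((k, p), l). if p \<in> P then atom k p l z *\<^sub>C coefficient k p l h else 0"
  let ?I = "((UNIV :: nat set) \<times> P) \<times> (UNIV :: nat set)"
  have F: "\<Phi> i z *\<^sub>C \<alpha> h i = ?F (idx i)" for i
    by (auto simp: \<Phi>_def \<alpha>_def split: prod.split)
  have "(\<lambda>i. (\<lambda>((k, p), l). cmod (atom k p l z)) i * C) summable_on ?I"
    by (rule summable_on_cmult_left[OF atom_summable[OF z]])
  then have "(\<lambda>i. norm (?F i)) summable_on ?I"
    by (rule Infinite_Sum.abs_summable_on_comparison_test')
      (auto simp: norm_scaleC intro!: mult_left_mono C)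
  then obtain y where y: "(?F has_sum y) ?I"
    using abs_summable_summable summable_on_def by blast
  have "y = h z"
  proof (rule ccontr)
    assume "y \<noteq> h z"
    then obtain \<phi> where \<phi>: "bounded_linear \<phi>" "\<And>a x. \<phi> (a *\<^sub>C x) = a * \<phi> x" "\<phi> (y - h z) \<noteq> 0"
      using exists_separating_complex_functional[of "y - h z"] by auto
    have hU: "h vholomorphic_on U" "bounded (h ` U)" using h by (auto simp: H_inf_def)
    obtain K where K: "\<And>x. norm (\<phi> x) \<le> norm x * K" "K \<ge> 0"
      using bounded_linear.nonneg_bounded[OF \<phi>(1)] by blast
    define f where "f w = \<phi> (h w)" for w
    have f: "f holomorphic_on U"
      unfolding f_def[abs_def] by (rule bounded_linear_comp_holomorphic[OF hU(1) \<phi>(1,2)])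
    have fb: "bounded (f ` U)"
      using bounded_linear_image[OF hU(2) \<phi>(1)] by (simp add: f_def[abs_def] image_image)
    have coef: "integral (cell k) (\<lambda>x. density k p l x * f (\<gamma> p x)) = \<phi> (coefficient k p l h)"
      if "p \<in> P" for k p l
      unfolding f_def by (rule coefficient_linear[OF that hU(1) \<phi>(1,2), symmetric])
    have "((\<lambda>((k, p), l). atom k p l z * integral (cell k) (\<lambda>x. density k p l x * f (\<gamma> p x)))
        has_sum f z) ?I"
    proof (rule scalar_expansion[OF z holomorphic_on_imp_continuous_on[OF f] _ cauchy[OF f fb z]])
      fix k l p assume p: "p \<in> P"
      have "norm (\<phi> (coefficient k p l h)) \<le> C * K"
        using K(1)[of "coefficient k p l h"] mult_right_mono[OF C[OF p] K(2)] order_trans by blast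
      then show "cmod (integral (cell k) (\<lambda>x. density k p l x * f (\<gamma> p x))) \<le> C * K"
        by (simp add: coef[OF p])
    qed
    moreover have "((\<lambda>i. \<phi> (?F i)) has_sum \<phi> y) ?I"
      by (rule has_sum_bounded_linear[OF \<phi>(1) y])
    then have "((\<lambda>((k, p), l). atom k p l z * integral (cell k) (\<lambda>x. density k p l x * f (\<gamma> p x)))
        has_sum \<phi> y) ?I"
      by (rule has_sum_cong[THEN iffD1, rotated]) (auto simp: \<phi>(2) coef)
    ultimately have "f z = \<phi> y" by (rule has_sum_unique)
    then show False using \<phi>(3) linear_simps(2)[OF \<phi>(1)] by (simp add: f_def)
  qed
  then have "((\<lambda>i. ?F (idx i)) has_sum h z) UNIV"
    using y by (subst has_sum_idx) auto
  then show ?thesis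
    unfolding F by (rule has_sum_imp_sums)
qed

end

section \<open>Primitives and logarithms along a contour\<close>

text \<open>Subtracting \<open>H z\<close> removes the pole at \<open>z\<close>, so convexity
  supplies a primitive. What is left of the Cauchy integrand is \<open>H z / (w - z)\<close>, which
  is integrated by a logarithm.\<close>

lemma difference_quotient_primitive:
  assumes "H holomorphic_on U" "open U" "convex U"
  obtains Q where "\<And>w. w \<in> U \<Longrightarrow> w \<noteq> z \<Longrightarrow> (Q has_field_derivative (H w - H z) / (w - z)) (at w)"
proof (cases "U = {}")
  case True then show ?thesis using that by blast
next
  case False
  let ?q = "\<lambda>w. if w = z then deriv H z else (H w - H z) / (w - z)"
  have q: "?q holomorphic_on U" by (rule pole_lemma_open[OF assms(1,2)])
  have "\<exists>Q. \<forall>w\<in>U. (Q has_field_derivative ?q w) (at w)"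
    using holomorphic_starlike_primitive[OF holomorphic_on_imp_continuous_on[OF q]
        convex_imp_starlike[OF assms(3) False] assms(2) finite.emptyI]
      holomorphic_on_imp_differentiable_at[OF q assms(2)] by blast
  then obtain Q where Q: "\<And>w. w \<in> U \<Longrightarrow> (Q has_field_derivative ?q w) (at w)" by blast
  show ?thesis
  proof (rule that[of Q])
    fix w assume "w \<in> U" "w \<noteq> z"
    then show "(Q has_field_derivative (H w - H z) / (w - z)) (at w)" using Q[of w] by simp
  qed
qed

text \<open>A branch of \<open>log (w - z)\<close> carried along by an angle: rotating by
  \<open>- \<phi>\<close> keeps the argument of \<open>Ln\<close> in the right half plane, off the
  cut, and \<open>\<i> * \<phi>\<close> restores what the rotation removed. The branch thus records
  how far \<phi> has turned.\<close>

lemma vector_derivative_Ln_rotated: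
  assumes w: "(w has_vector_derivative w') (at x within S)"
    and \<phi>: "(\<phi> has_real_derivative \<phi>') (at x within S)"
    and pos: "0 < Re ((w x - z) * cis (- \<phi> x))"
  shows "((\<lambda>x. Ln ((w x - z) * cis (- \<phi> x)) + \<i> * of_real (\<phi> x)) has_vector_derivative w' / (w x - z))
    (at x within S)"
proof -
  let ?c = "\<lambda>x. exp (of_real (\<phi> x) * (- \<i>)) :: complex"
  have cis: "cis (- \<phi> x) = ?c x" for x by (simp add: cis_conv_exp mult.commute)
  have \<phi>v: "((\<lambda>x. of_real (\<phi> x)) has_vector_derivative (of_real \<phi>' :: complex)) (at x within S)"
    by (rule has_vector_derivative_of_real[OF \<phi>])
  have "((\<lambda>x. of_real (\<phi> x) * (- \<i>)) has_vector_derivative of_real \<phi>' * (- \<i>)) (at x within S)"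
    by (rule has_vector_derivative_mult_left[OF \<phi>v])
  from field_vector_diff_chain_within[OF this, of exp "?c x"]
  have cv: "(?c has_vector_derivative of_real \<phi>' * (- \<i>) * ?c x) (at x within S)"
    by (simp add: o_def has_field_derivative_at_within)
  have wv: "((\<lambda>x. w x - z) has_vector_derivative w') (at x within S)"
    using has_vector_derivative_diff[OF w has_vector_derivative_const[of z]] by simp
  have nn: "(w x - z) * ?c x \<notin> \<real>\<^sub>\<le>\<^sub>0"
    using pos unfolding cis by (auto simp: complex_nonpos_Reals_iff)
  then have nz: "w x - z \<noteq> 0" "?c x \<noteq> 0" by auto
  have "((\<lambda>x. (w x - z) * ?c x) has_vector_derivative
      ((w x - z) * (of_real \<phi>' * (- \<i>) * ?c x) + w' * ?c x)) (at x within S)"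
    by (rule has_vector_derivative_mult[OF wv cv])
  from field_vector_diff_chain_within[OF this, of Ln "inverse ((w x - z) * ?c x)"]
  have "((\<lambda>x. Ln ((w x - z) * ?c x)) has_vector_derivative
      ((w x - z) * (of_real \<phi>' * (- \<i>) * ?c x) + w' * ?c x) * inverse ((w x - z) * ?c x)) (at x within S)"
    using has_field_derivative_Ln[OF nn] by (simp add: o_def has_field_derivative_at_within)
  from has_vector_derivative_add[OF this has_vector_derivative_mult_right[OF \<phi>v, of \<i>]]
  show ?thesis
    unfolding cis by (rule has_vector_derivative_eq_rhs) (use nz in \<open>simp add: field_simps\<close>)
qed

text \<open>The argument of \<open>u\<close> is below \<open>pi / 2\<close> in modulus, so adding
  \<beta> does not reach the cut.\<close>

lemma Ln_times_cis:
  assumes "Re u > 0" "\<bar>\<beta>\<bar> < pi / 2"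
  shows "Ln (u * cis \<beta>) = Ln u + \<i> * of_real \<beta>" "u * cis \<beta> \<notin> \<real>\<^sub>\<le>\<^sub>0"
proof -
  have u: "u \<noteq> 0" using assms by auto
  have "\<bar>Im (Ln u)\<bar> < pi / 2" using Re_Ln_pos_lt[OF u] assms by simp
  then have im: "\<bar>Im (Ln u + \<i> * of_real \<beta>)\<bar> < pi" using assms by simp
  show *: "Ln (u * cis \<beta>) = Ln u + \<i> * of_real \<beta>"
    by (rule Ln_unique) (use im u in \<open>auto simp: exp_add cis_conv_exp\<close>)
  define v where "v = u * cis \<beta>"
  have "v \<noteq> 0" "Im (Ln v) \<noteq> pi" using u im unfolding v_def * by auto
  then have "v \<notin> \<real>\<^sub>\<le>\<^sub>0"
    using Im_Ln_eq_pi[of v] by (auto simp: complex_nonpos_Reals_iff less_le complex_eq_iff)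
  then show "u * cis \<beta> \<notin> \<real>\<^sub>\<le>\<^sub>0" by (simp add: v_def)
qed

lemma sorted_angles:
  assumes "finite E" "E \<noteq> {}" "E \<subseteq> sphere 0 1"
  obtains N and \<theta> :: "nat \<Rightarrow> real" where "N > 0" "\<And>j. j < N \<Longrightarrow> \<theta> j < \<theta> (Suc j)"
    "\<theta> N = \<theta> 0 + 2 * pi" "E = (\<lambda>j. cis (\<theta> j)) ` {..<N}"
proof -
  define xs where "xs = sorted_list_of_set (Arg2pi ` E)"
  define N where "N = length xs"
  \<comment> \<open>Index \<open>N\<close> repeats the first angle one turn later, so that the
    cyclic gap after the last point is treated like the others.\<close>
  define \<theta> where "\<theta> j = (if j < N then xs ! j else xs ! 0 + 2 * pi)" for j
  have set: "set xs = Arg2pi ` E" and srt: "sorted_wrt (<) xs"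
    using assms(1) by (auto simp: xs_def strict_sorted_list_of_set)
  have N: "N > 0" using set assms(2) by (auto simp: N_def)
  have "\<theta> j < \<theta> (Suc j)" if "j < N" for j
  proof (cases "Suc j < N")
    case True then show ?thesis
      using sorted_wrt_nth_less[OF srt, of j "Suc j"] by (simp add: \<theta>_def N_def)
  next
    case False
    have rng: "0 \<le> xs ! i \<and> xs ! i < 2 * pi" if "i < N" for i
    proof -
      have "xs ! i \<in> Arg2pi ` E" using nth_mem[of i xs] that unfolding N_def set by simp
      then show ?thesis using Arg2pi by auto
    qed
    show ?thesis using False that rng[OF that] rng[OF N] by (simp add: \<theta>_def)
  qed
  moreover have "E = (\<lambda>j. cis (\<theta> j)) ` {..<N}"
  proof -
    have "cis (Arg2pi \<xi>) = \<xi>" if "\<xi> \<in> E" for \<xi>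
      using complex_norm_eq_1_exp[of \<xi>] that assms(3) by (auto simp: cis_conv_exp)
    then have "cis ` set xs = (\<lambda>\<xi>. \<xi>) ` E"
      unfolding set image_image by (intro image_cong refl)
    then have "E = cis ` set xs" by simp
    also have "set xs = \<theta> ` {..<N}" by (auto simp: \<theta>_def N_def in_set_conv_nth)
    finally show ?thesis by (simp add: image_image)
  qed
  ultimately show ?thesis using that[of N \<theta>] N by (simp add: \<theta>_def)
qed

text \<open>
  \<open>w1\<close> and \<open>w2\<close> run along the two legs at the corner \<open>\<xi>\<close>. The integrand is of size \<open>x powr (-1/2)\<close>
  on the gap between them, which has length \<open>O(x)\<close>.
\<close>

lemma primitive_gap_tendsto:
  fixes Q H :: "complex \<Rightarrow> complex" and w1 w2 :: "real \<Rightarrow> complex"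
  assumes U: "convex U" and z: "z \<noteq> \<xi>" and c: "c > 0"
    and Q: "\<And>w. w \<in> U \<Longrightarrow> w \<noteq> z \<Longrightarrow> (Q has_field_derivative (H w - Hz) / (w - z)) (at w)"
    and H: "\<And>w d. w \<in> U \<Longrightarrow> 0 < d \<Longrightarrow> d \<le> 1 - cmod w \<Longrightarrow> cmod (H w) \<le> c / sqrt d"
    and \<kappa>: "\<kappa> > 0"
    and w: "\<And>x. 0 < x \<Longrightarrow> x \<le> 1 \<Longrightarrow> w1 x \<in> U \<and> w2 x \<in> U \<and>
      cmod (w1 x) \<le> 1 - \<kappa> * x \<and> cmod (w2 x) \<le> 1 - \<kappa> * x \<and>
      cmod (w1 x - \<xi>) \<le> 2 * x \<and> cmod (w2 x - \<xi>) \<le> 2 * x"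
  shows "((\<lambda>x. Q (w1 x) - Q (w2 x)) \<longlongrightarrow> 0) (at_right 0)"
proof (rule Lim_null_comparison)
  define e where "e = cmod (z - \<xi>)"
  have e: "e > 0" using z by (simp add: e_def)
  let ?b = "\<lambda>x. (c / sqrt (\<kappa> * x) + cmod Hz) / (e / 2) * (4 * x)"
  have "\<forall>\<^sub>F x in at_right (0::real). x \<in> {0<..<min 1 (e / 4)}"
    using e by (intro eventually_at_right_real) simp
  then show "\<forall>\<^sub>F x in at_right 0. cmod (Q (w1 x) - Q (w2 x)) \<le> ?b x"
  proof eventually_elim
    case (elim x)
    then have x: "0 < x" "x \<le> 1" "4 * x < e" by auto
    \<comment> \<open>A convex set containing both end points on which the mean value inequality
      applies: it stays at distance \<open>\<kappa> * x\<close> from the unit circle, which bounds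
      \<open>H\<close>, and at distance \<open>e / 2\<close> from \<open>z\<close>, which bounds the
      kernel.\<close>
    let ?S = "U \<inter> cball 0 (1 - \<kappa> * x) \<inter> cball \<xi> (2 * x)"
    have \<kappa>x: "\<kappa> * x > 0" using \<kappa> x by simp
    have far: "e / 2 \<le> cmod (w - z)" if "w \<in> ?S" for w
      using that norm_triangle_ineq4[of "\<xi> - w" "z - w"] x
      by (auto simp: dist_norm e_def norm_minus_commute)
    have "cmod (Q (w1 x) - Q (w2 x)) \<le> (c / sqrt (\<kappa> * x) + cmod Hz) / (e / 2) * cmod (w1 x - w2 x)"
    proof (rule field_differentiable_bound[where S = ?S and f' = "\<lambda>w. (H w - Hz) / (w - z)"])
      show "convex ?S" using U by (intro convex_Int convex_cball)
      show "w1 x \<in> ?S" "w2 x \<in> ?S" using w[OF x(1,2)] by (auto simp: dist_norm norm_minus_commute)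
      fix w assume wS: "w \<in> ?S"
      show "(Q has_field_derivative (H w - Hz) / (w - z)) (at w within ?S)"
        using wS far[OF wS] e by (intro has_field_derivative_at_within[OF Q]) auto
      have "cmod (H w) \<le> c / sqrt (\<kappa> * x)"
        using wS \<kappa>x by (intro H) auto
      then have "cmod (H w - Hz) \<le> c / sqrt (\<kappa> * x) + cmod Hz"
        using norm_triangle_ineq4[of "H w" Hz] by linarith
      then show "cmod ((H w - Hz) / (w - z)) \<le> (c / sqrt (\<kappa> * x) + cmod Hz) / (e / 2)"
        unfolding norm_divide using far[OF wS] e c \<kappa>x by (intro frac_le) auto
    qed
    also have "\<dots> \<le> ?b x"
    proof (rule mult_left_mono)
      show "cmod (w1 x - w2 x) \<le> 4 * x"
        using w[OF x(1,2)] norm_triangle_ineq4[of "w1 x - \<xi>" "w2 x - \<xi>"] by simp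
    qed (use c e \<kappa>x in simp)
    finally show ?case .
  qed
  have "(?b \<longlongrightarrow> 0) (at_right 0)"
  proof (rule Lim_transform_eventually)
    show "((\<lambda>x. 8 / e * (c / sqrt \<kappa> * sqrt x + cmod Hz * x)) \<longlongrightarrow> 0) (at_right 0)"
      by (rule tendsto_eq_intros refl | simp)+
    have "\<forall>\<^sub>F x in at_right (0::real). 0 < x" by (rule eventually_at_right_less)
    then show "\<forall>\<^sub>F x in at_right 0. 8 / e * (c / sqrt \<kappa> * sqrt x + cmod Hz * x) = ?b x"
    proof eventually_elim
      case (elim x)
      have "x / sqrt x = sqrt x" using elim by (simp add: real_div_sqrt)
      then have "c / sqrt \<kappa> * sqrt x = c / sqrt \<kappa> * (x / sqrt x)" by (simp only:)
      also have "\<dots> = c / sqrt (\<kappa> * x) * x" by (simp add: real_sqrt_mult)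
      finally have "c / sqrt \<kappa> * sqrt x = c / sqrt (\<kappa> * x) * x" .
      then show ?case by (simp only:) (simp add: field_simps)
    qed
  qed
  then show "(?b \<longlongrightarrow> 0) (at_right 0)" .
qed

section \<open>The contour around the domain\<close>

lemma E_dom_open: "open (E_dom E r)" by (simp add: E_dom_def)

lemma E_dom_convex: "convex (E_dom E r)" by (simp add: E_dom_def convex_interior)

lemma ball_subset_E_dom: "ball 0 r \<subseteq> E_dom E r"
  unfolding E_dom_def by (intro interior_maximal open_ball) (meson hull_subset sup.bounded_iff)

lemma E_dom_mono: "r \<le> s \<Longrightarrow> E_dom E r \<subseteq> E_dom E s"
  unfolding E_dom_def by (intro interior_mono hull_mono) auto

lemma E_dom_subset_ball:
  assumes "E \<subseteq> sphere 0 1" "r \<le> 1"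
  shows "E_dom E r \<subseteq> ball 0 1"
proof -
  have "convex hull (E \<union> ball 0 r) \<subseteq> cball 0 1"
    using assms by (intro hull_minimal) auto
  then show ?thesis
    unfolding E_dom_def using interior_mono interior_cball by metis
qed

lemma E_dom_support:
  assumes "\<And>\<eta>. \<eta> \<in> E \<Longrightarrow> inner u \<eta> \<le> r" "norm u \<le> 1" "z \<in> E_dom E r"
  shows "inner u z \<le> r"
proof -
  have "inner u z \<le> r" if "z \<in> ball 0 r" for z
  proof -
    have "inner u z \<le> norm u * norm z" by (rule norm_cauchy_schwarz)
    also have "\<dots> \<le> 1 * norm z" using assms(2) by (intro mult_right_mono) auto
    finally show ?thesis using that by simp
  qed
  then have "convex hull (E \<union> ball 0 r) \<subseteq> {z. inner u z \<le> r}"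
    using assms(1) by (intro hull_minimal convex_halfspace_le) auto
  then show ?thesis using assms(3) interior_subset unfolding E_dom_def by blast
qed

lemma inner_cis_cis: "inner (cis a) (cis b) = cos (a - b)"
  by (simp add: inner_complex_def cos_diff)

lemma Re_mult_cis_minus: "Re (w * cis (- \<phi>)) = inner (cis \<phi>) w"
  by (simp add: inner_complex_def)

lemma cis_add_2pi [simp]: "cis (a + 2 * pi) = cis a"
  by (simp flip: cis_mult)

lemma norm_cis_diff_le: "cmod (cis a - cis b) \<le> \<bar>a - b\<bar>"
proof -
  define d where "d = (a - b) / 2"
  have ab: "a - b = 2 * d" by (simp add: d_def)
  have "(cmod (cis a - cis b))\<^sup>2 = 2 - 2 * cos (a - b)"
    by (simp add: cmod_power2 cos_diff power2_diff algebra_simps)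
  also have "\<dots> = (2 * sin d)\<^sup>2"
    unfolding ab using cos_double_sin[of d] by (simp add: power2_eq_square)
  also have "\<dots> \<le> (a - b)\<^sup>2"
    unfolding ab using abs_sin_x_le_abs_x[of d] by (subst abs_le_square_iff[symmetric]) (simp add: abs_mult)
  finally show ?thesis by (simp add: abs_le_square_iff[symmetric])
qed

lemma cos_le_cos_outside:
  assumes "0 \<le> b" "b \<le> y" "y \<le> 2 * pi - b"
  shows "cos y \<le> cos b"
proof (cases "y \<le> pi")
  case True then show ?thesis using assms by (intro cos_monotone_0_pi_le) auto
next
  case False
  then have "cos (2 * pi - y) \<le> cos b" using assms by (intro cos_monotone_0_pi_le) auto
  then show ?thesis by (simp add: cos_diff)
qed

section \<open>Legs, arcs and the cyclic arrangement of the corners\<close>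

definition leg :: "real \<Rightarrow> real \<Rightarrow> real \<Rightarrow> real \<Rightarrow> complex"
  where "leg t \<theta> \<phi> x = (1 - x) *\<^sub>R cis \<theta> + (x * t) *\<^sub>R cis \<phi>"

definition arc_angle :: "real \<Rightarrow> real \<Rightarrow> real \<Rightarrow> real"
  where "arc_angle \<phi>1 \<phi>2 x = (1 - x) * \<phi>1 + x * \<phi>2"

definition circ :: "real \<Rightarrow> real \<Rightarrow> complex"
  where "circ t \<phi> = t *\<^sub>R cis \<phi>"

lemma leg_0 [simp]: "leg t \<theta> \<phi> 0 = cis \<theta>" and leg_1 [simp]: "leg t \<theta> \<phi> 1 = circ t \<phi>"
  by (simp_all add: leg_def circ_def)

lemma leg_diff: "leg t \<theta> \<phi> x - leg t \<theta> \<phi> y = (x - y) *\<^sub>R (circ t \<phi> - cis \<theta>)"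
  by (simp add: leg_def circ_def algebra_simps)

lemma norm_circ_minus_cis_le: "0 \<le> t \<Longrightarrow> t \<le> 1 \<Longrightarrow> cmod (circ t \<phi> - cis \<theta>) \<le> 2"
  using norm_triangle_ineq4[of "circ t \<phi>" "cis \<theta>"] by (simp add: circ_def)

lemma norm_leg_diff_le:
  assumes "0 \<le> t" "t \<le> 1"
  shows "cmod (leg t \<theta> \<phi> x - leg t \<theta> \<phi> y) \<le> 2 * \<bar>x - y\<bar>"
  unfolding leg_diff using mult_left_mono[OF norm_circ_minus_cis_le[OF assms, of \<phi> \<theta>], of "\<bar>x - y\<bar>"]
  by (simp add: mult.commute)

lemma norm_leg_le:
  assumes "0 \<le> t" "0 \<le> x" "x \<le> 1"
  shows "cmod (leg t \<theta> \<phi> x) \<le> 1 - (1 - t) * x"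
proof -
  have "cmod (leg t \<theta> \<phi> x) \<le> cmod ((1 - x) *\<^sub>R cis \<theta>) + cmod ((x * t) *\<^sub>R cis \<phi>)"
    unfolding leg_def by (rule norm_triangle_ineq)
  also have "\<dots> = (1 - x) + x * t" using assms by simp
  also have "\<dots> = 1 - (1 - t) * x" by (simp add: algebra_simps)
  finally show ?thesis .
qed

text \<open>For \<open>cos (\<phi> - \<theta>) = r\<close> the right-hand side is
  \<open>r + x * (t - r)\<close>: the leg starts on the supporting line at level \<open>r\<close>
  and leaves it linearly.\<close>

lemma inner_leg: "inner (cis \<phi>) (leg t \<theta> \<phi> x) = (1 - x) * cos (\<phi> - \<theta>) + x * t"
  by (simp add: leg_def inner_add_right inner_cis_cis)

lemma leg_in_E_dom:
  assumes "cis \<theta> \<in> E" "0 \<le> t" "t < s" "t < 1" "0 < x" "x \<le> 1"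
  shows "leg t \<theta> \<phi> x \<in> E_dom E s"
proof (cases "x = 1")
  case True
  then show ?thesis using ball_subset_E_dom[of s E] assms by (auto simp: circ_def)
next
  case False
  have a: "circ t \<phi> \<in> E_dom E s" using ball_subset_E_dom[of s E] assms by (auto simp: circ_def)
  have "cis \<theta> \<in> convex hull (E \<union> ball 0 s)" using assms(1) by (auto intro: hull_inc)
  then have "open_segment (circ t \<phi>) (cis \<theta>) \<subseteq> E_dom E s"
    using a unfolding E_dom_def
    by (intro in_interior_closure_convex_segment convex_convex_hull) (auto intro: closure_subset[THEN subsetD])
  moreover have "circ t \<phi> \<noteq> cis \<theta>"
  proof
    assume "circ t \<phi> = cis \<theta>"
    then have "cmod (circ t \<phi>) = cmod (cis \<theta>)" by simp
    then show False using assms by (simp add: circ_def)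
  qed
  then have "leg t \<theta> \<phi> x \<in> open_segment (circ t \<phi>) (cis \<theta>)"
    using assms False unfolding in_segment
    by (intro conjI exI[of _ "1 - x"]) (auto simp: leg_def circ_def)
  ultimately show ?thesis by blast
qed

text \<open>Because \<open>cos \<beta> = r\<close>, the tangents from
  \<open>cis (\<theta> j)\<close> to the circle of radius \<open>r\<close> touch it at the angles
  \<open>\<theta> j - \<beta>\<close> and \<open>\<theta> j + \<beta>\<close>. The condition
  \<open>gap\<close> says that the tangency points belonging to consecutive corners do not pass each
  other, so the arc between them is run through forwards.\<close>

locale corner_data =
  fixes E :: "complex set" and r s t \<beta> :: real and N :: nat and \<theta> :: "nat \<Rightarrow> real"
  assumes r: "0 < r" "r < t" "t < s" "s < 1"
    and \<beta>: "cos \<beta> = r" "0 < \<beta>" "\<beta> < pi / 2"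
    and N: "N > 0" and \<theta>_less: "\<And>j. j < N \<Longrightarrow> \<theta> j < \<theta> (Suc j)"
    and \<theta>_N: "\<theta> N = \<theta> 0 + 2 * pi" and E_eq: "E = (\<lambda>j. cis (\<theta> j)) ` {..<N}"
    and gap: "\<And>j. j < N \<Longrightarrow> \<theta> j + 2 * \<beta> \<le> \<theta> (Suc j)"
begin

lemma finite_E: "finite E" and E_sphere: "E \<subseteq> sphere 0 1"
  by (auto simp: E_eq)

lemma cis_\<theta>: "j \<le> N \<Longrightarrow> cis (\<theta> j) \<in> E"
  using N by (cases "j = N") (auto simp: E_eq \<theta>_N)

lemma \<theta>_mono: "i \<le> j \<Longrightarrow> j \<le> N \<Longrightarrow> \<theta> i \<le> \<theta> j"
proof (induction j rule: dec_induct)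
  case (step n)
  then show ?case using \<theta>_less[of n] by simp
qed simp

abbreviation "\<phi>1 j \<equiv> \<theta> j + \<beta>"
abbreviation "\<phi>2 j \<equiv> \<theta> (Suc j) - \<beta>"

lemma arc_range: "j < N \<Longrightarrow> 0 \<le> \<phi>2 j - \<phi>1 j" "j < N \<Longrightarrow> \<phi>2 j - \<phi>1 j \<le> 2 * pi"
  using gap[of j] \<theta>_mono[of 0 j] \<theta>_mono[of "Suc j" N] \<theta>_N \<beta> by auto

text \<open>An angle between the two tangency points of a gap is at least \<beta> away from every
  corner, in both directions around the circle, so all of \<open>E\<close> lies in the half plane at
  level \<open>cos \<beta>\<close>.\<close>

lemma support:
  assumes j: "j < N" and \<phi>: "\<phi>1 j \<le> \<phi>" "\<phi> \<le> \<phi>2 j" and z: "z \<in> E_dom E r"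
  shows "inner (cis \<phi>) z \<le> r"
proof (rule E_dom_support[OF _ _ z])
  fix \<eta> assume "\<eta> \<in> E"
  then obtain i where i: "i < N" "\<eta> = cis (\<theta> i)" by (auto simp: E_eq)
  have "cos (\<phi> - \<theta> i) \<le> cos \<beta>"
  proof (cases "i \<le> j")
    case True
    have "\<theta> i \<le> \<theta> j" "\<theta> (Suc j) \<le> \<theta> N" "\<theta> 0 \<le> \<theta> i" using True j i by (auto intro!: \<theta>_mono)
    then show ?thesis using \<phi> \<beta> \<theta>_N by (intro cos_le_cos_outside) auto
  next
    case False
    have "\<theta> (Suc j) \<le> \<theta> i" "\<theta> i \<le> \<theta> N" "\<theta> 0 \<le> \<theta> j" using False j i by (auto intro!: \<theta>_mono)
    then have "cos (\<theta> i - \<phi>) \<le> cos \<beta>" using \<phi> \<beta> \<theta>_N by (intro cos_le_cos_outside) auto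
    then show ?thesis by (metis cos_minus minus_diff_eq)
  qed
  then show "inner (cis \<phi>) \<eta> \<le> r" by (simp add: i inner_cis_cis \<beta>)
qed simp

lemma arc_angle_range:
  assumes "j < N" "0 \<le> x" "x \<le> 1"
  shows "\<phi>1 j \<le> arc_angle (\<phi>1 j) (\<phi>2 j) x" "arc_angle (\<phi>1 j) (\<phi>2 j) x \<le> \<phi>2 j"
proof -
  have *: "arc_angle (\<phi>1 j) (\<phi>2 j) x = \<phi>1 j + x * (\<phi>2 j - \<phi>1 j)"
    by (simp add: arc_angle_def algebra_simps)
  have "0 \<le> x * (\<phi>2 j - \<phi>1 j)" "x * (\<phi>2 j - \<phi>1 j) \<le> \<phi>2 j - \<phi>1 j"
    by (rule mult_nonneg_nonneg[OF assms(2) arc_range(1)[OF assms(1)]],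
        rule mult_left_le_one_le[OF arc_range(1)[OF assms(1)] assms(2,3)])
  then show "\<phi>1 j \<le> arc_angle (\<phi>1 j) (\<phi>2 j) x" "arc_angle (\<phi>1 j) (\<phi>2 j) x \<le> \<phi>2 j"
    unfolding * by linarith+
qed

text \<open>Both kinds of legs start at their corner, so that \<open>x\<close> tending to 0 means
  approaching it. An arc has no corner at \<open>x = 0\<close> but shares the parameter interval,
  and there the bounds linear in \<open>x\<close> follow from those at \<open>x = 1\<close>.\<close>

definition path :: "nat \<times> nat \<Rightarrow> real \<Rightarrow> complex"
  where "path p x = (case p of (j, i) \<Rightarrow>
    if i = 0 then leg t (\<theta> j) (\<phi>1 j) x
    else if i = 1 then circ t (arc_angle (\<phi>1 j) (\<phi>2 j) x)
    else leg t (\<theta> (Suc j)) (\<phi>2 j) x)"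

text \<open>The derivative of the piece, up to the sign that accounts for the leg towards the next
  corner being parametrised backwards.\<close>

definition speed :: "nat \<times> nat \<Rightarrow> real \<Rightarrow> complex"
  where "speed p x = (case p of (j, i) \<Rightarrow>
    if i = 0 then circ t (\<phi>1 j) - cis (\<theta> j)
    else if i = 1 then \<i> * of_real (\<phi>2 j - \<phi>1 j) * circ t (arc_angle (\<phi>1 j) (\<phi>2 j) x)
    else cis (\<theta> (Suc j)) - circ t (\<phi>2 j))"

definition pieces :: "(nat \<times> nat) set" where "pieces = {..<N} \<times> {0, 1, 2}"

text \<open>A supporting line separates the point from the inner domain: the line at the tangency
  angle for a leg, the one at the point's own angle for an arc.\<close>

lemma inner_path_ge:
  assumes "p \<in> pieces" "0 < x" "x \<le> 1" "z \<in> E_dom E r"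
  shows "\<exists>\<phi>. (t - r) * x \<le> inner (cis \<phi>) (path p x - z)"
proof -
  have leg: "(t - r) * x \<le> inner (cis \<phi>) (leg t \<psi> \<phi> x - z)"
    if "inner (cis \<phi>) z \<le> r" "cos (\<phi> - \<psi>) = r" for \<phi> \<psi>
    using that by (simp add: inner_diff_right inner_leg algebra_simps)
  obtain j i where p: "p = (j, i)" "j < N" "i = 0 \<or> i = 1 \<or> i = 2"
    using assms(1) by (auto simp: pieces_def)
  note sup = support[OF p(2) _ _ assms(4)]
  have *: ?thesis if "i = 0"
    using leg[OF sup[of "\<phi>1 j"], of "\<theta> j"] arc_range[OF p(2)] that \<beta>
    by (intro exI[of _ "\<phi>1 j"]) (simp add: path_def p)
  have **: ?thesis if "i = 2"
    using leg[OF sup[of "\<phi>2 j"], of "\<theta> (Suc j)"] arc_range[OF p(2)] that \<beta>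
    by (intro exI[of _ "\<phi>2 j"]) (simp add: path_def p)
  have ***: ?thesis if "i = 1"
  proof -
    let ?\<phi> = "arc_angle (\<phi>1 j) (\<phi>2 j) x"
    have "(t - r) * x \<le> (t - r) * 1" using r assms by (intro mult_left_mono) auto
    moreover have "inner (cis ?\<phi>) z \<le> r"
      using arc_angle_range[OF p(2), of x] assms by (intro sup) auto
    ultimately show ?thesis using that
      by (intro exI[of _ ?\<phi>]) (simp add: path_def p circ_def inner_diff_right inner_cis_cis)
  qed
  show ?thesis using * ** *** p(3) by blast
qed

end

lemma prod_dist_le:
  assumes "finite E" "E \<subseteq> sphere 0 1" "\<xi>0 \<in> E" "z \<in> ball (0::complex) 1"
  shows "(\<Prod>\<xi>\<in>E. cmod (\<xi> - z)) \<le> 2 ^ card E * cmod (\<xi>0 - z)"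
proof -
  have 2: "cmod (\<xi> - z) \<le> 2" if "\<xi> \<in> E" for \<xi>
    using norm_triangle_ineq4[of \<xi> z] that assms by auto
  have "(\<Prod>\<xi>\<in>E. cmod (\<xi> - z)) = cmod (\<xi>0 - z) * (\<Prod>\<xi>\<in>E - {\<xi>0}. cmod (\<xi> - z))"
    by (rule prod.remove[OF assms(1,3)])
  also have "\<dots> \<le> cmod (\<xi>0 - z) * (\<Prod>\<xi>\<in>E - {\<xi>0}. 2)"
    using 2 by (intro mult_left_mono prod_mono) auto
  also have "\<dots> \<le> cmod (\<xi>0 - z) * 2 ^ card E"
    using assms by (intro mult_left_mono) (auto intro!: power_increasing)
  finally show ?thesis by (simp add: mult.commute)
qed

text \<open>The limit is free of \<beta>. Used with \<beta> and \<open>- \<beta>\<close>, it shows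
  that the logarithm branches carried by the two legs at a corner agree there.\<close>

lemma corner_log_tendsto:
  assumes z: "cmod z < 1" and \<beta>: "\<bar>\<beta>\<bar> < pi / 2"
  shows "((\<lambda>x. Ln ((leg t \<theta> (\<theta> - \<beta>) x - z) * cis (- (\<theta> - \<beta>))) + \<i> * of_real (\<theta> - \<beta>))
    \<longlongrightarrow> Ln ((cis \<theta> - z) * cis (- \<theta>)) + \<i> * of_real \<theta>) (at_right 0)"
proof -
  define u where "u = (cis \<theta> - z) * cis (- \<theta>)"
  have "inner (cis \<theta>) z < 1"
    using norm_cauchy_schwarz[of "cis \<theta>" z] z by simp
  then have u: "Re u > 0"
    unfolding u_def Re_mult_cis_minus by (simp add: inner_diff_right inner_cis_cis)
  have "cis (- (\<theta> - \<beta>)) = cis (- \<theta>) * cis \<beta>" by (simp add: cis_mult)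
  then have lim: "(leg t \<theta> (\<theta> - \<beta>) 0 - z) * cis (- (\<theta> - \<beta>)) = u * cis \<beta>"
    by (simp add: u_def)
  have "((\<lambda>x. (leg t \<theta> (\<theta> - \<beta>) x - z) * cis (- (\<theta> - \<beta>))) \<longlongrightarrow> u * cis \<beta>) (at_right 0)"
    unfolding lim[symmetric] leg_def by (intro tendsto_intros)
  then have "((\<lambda>x. Ln ((leg t \<theta> (\<theta> - \<beta>) x - z) * cis (- (\<theta> - \<beta>))) + \<i> * of_real (\<theta> - \<beta>))
    \<longlongrightarrow> Ln (u * cis \<beta>) + \<i> * of_real (\<theta> - \<beta>)) (at_right 0)"
    by (intro tendsto_add tendsto_const tendsto_Ln Ln_times_cis(2)[OF u \<beta>])
  then show ?thesis
    using Ln_times_cis(1)[OF u \<beta>] by (simp add: u_def algebra_simps)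
qed

text \<open>\<open>V\<close> is a primitive along the path: \<open>Q\<close> for the difference
  quotient, plus \<open>Hz\<close> times the rotated logarithm. The positive inner product keeps the
  path away from both \<open>z\<close> and the cut.\<close>

lemma integral_along_path:
  fixes Q H :: "complex \<Rightarrow> complex"
  assumes "a \<le> b"
    and w: "\<And>x. x \<in> {a..b} \<Longrightarrow> (w has_vector_derivative w' x) (at x within {a..b})"
    and \<phi>: "\<And>x. x \<in> {a..b} \<Longrightarrow> (\<phi> has_real_derivative \<phi>' x) (at x within {a..b})"
    and pos: "\<And>x. x \<in> {a..b} \<Longrightarrow> 0 < inner (cis (\<phi> x)) (w x - z)"
    and U: "\<And>x. x \<in> {a..b} \<Longrightarrow> w x \<in> U"
    and Q: "\<And>w. w \<in> U \<Longrightarrow> w \<noteq> z \<Longrightarrow> (Q has_field_derivative (H w - Hz) / (w - z)) (at w)"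
    and V: "\<And>\<phi> w. V \<phi> w = Q w + Hz * (Ln ((w - z) * cis (- \<phi>)) + \<i> * of_real \<phi>)"
  shows "((\<lambda>x. H (w x) * w' x / (w x - z)) has_integral V (\<phi> b) (w b) - V (\<phi> a) (w a)) {a..b}"
proof (rule fundamental_theorem_of_calculus[OF \<open>a \<le> b\<close>])
  fix x assume x: "x \<in> {a..b}"
  have ne: "w x \<noteq> z" using pos[OF x] by auto
  have Q': "((\<lambda>x. Q (w x)) has_vector_derivative (w' x * ((H (w x) - Hz) / (w x - z)))) (at x within {a..b})"
    using field_vector_diff_chain_within[OF w[OF x] has_field_derivative_at_within[OF Q[OF U[OF x] ne]]]
    by (simp add: o_def)
  have "((\<lambda>x. Ln ((w x - z) * cis (- \<phi> x)) + \<i> * of_real (\<phi> x)) has_vector_derivative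
      w' x / (w x - z)) (at x within {a..b})"
    using pos[OF x] by (intro vector_derivative_Ln_rotated[OF w[OF x] \<phi>[OF x]]) (simp only: Re_mult_cis_minus)
  note D = has_vector_derivative_add[OF Q' has_vector_derivative_mult_right[OF this, of Hz]]
  show "((\<lambda>x. V (\<phi> x) (w x)) has_vector_derivative H (w x) * w' x / (w x - z)) (at x within {a..b})"
    unfolding V by (rule has_vector_derivative_eq_rhs[OF D]) (simp add: diff_divide_distrib right_diff_distrib mult.commute)
qed

lemma has_vector_derivative_leg:
  "(leg t \<theta> \<phi> has_vector_derivative (circ t \<phi> - cis \<theta>)) (at x within S)"
  unfolding leg_def[abs_def] circ_def
  by (auto intro!: derivative_eq_intros simp: has_vector_derivative_def algebra_simps fun_eq_iff)

lemma has_real_derivative_arc_angle: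
  "(arc_angle \<phi>1 \<phi>2 has_real_derivative (\<phi>2 - \<phi>1)) (at x within S)"
  unfolding arc_angle_def[abs_def] by (auto intro!: derivative_eq_intros)

lemma has_vector_derivative_circ_arc:
  "((\<lambda>x. circ t (arc_angle \<phi>1 \<phi>2 x)) has_vector_derivative
    \<i> * of_real (\<phi>2 - \<phi>1) * circ t (arc_angle \<phi>1 \<phi>2 x)) (at x within S)"
proof -
  have "((\<lambda>x. of_real (arc_angle \<phi>1 \<phi>2 x) * \<i>) has_vector_derivative of_real (\<phi>2 - \<phi>1) * \<i>) (at x within S)"
    by (intro has_vector_derivative_mult_left has_vector_derivative_of_real has_real_derivative_arc_angle)
  from field_vector_diff_chain_within[OF this, of exp "exp (of_real (arc_angle \<phi>1 \<phi>2 x) * \<i>)"]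
  have "((\<lambda>x. cis (arc_angle \<phi>1 \<phi>2 x)) has_vector_derivative
      of_real (\<phi>2 - \<phi>1) * \<i> * cis (arc_angle \<phi>1 \<phi>2 x)) (at x within S)"
    by (simp add: o_def cis_conv_exp mult.commute[of \<i>] has_field_derivative_at_within)
  from has_vector_derivative_mult_right[OF this, of "of_real t"]
  show ?thesis by (simp add: circ_def scaleR_conv_of_real mult_ac)
qed

section \<open>Estimates for the contour and Cauchy's formula on it\<close>

context corner_data
begin

lemma t_bounds: "0 < t" "t < 1" "r < 1" "r < s" "0 \<le> t" "t \<le> 1"
  using r by auto

lemma path_cases:
  assumes "p \<in> pieces"
  obtains j where "j < N" "\<And>x. path p x = leg t (\<theta> j) (\<phi>1 j) x" "\<And>x. speed p x = circ t (\<phi>1 j) - cis (\<theta> j)"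
  | j where "j < N" "\<And>x. path p x = circ t (arc_angle (\<phi>1 j) (\<phi>2 j) x)"
      "\<And>x. speed p x = \<i> * of_real (\<phi>2 j - \<phi>1 j) * circ t (arc_angle (\<phi>1 j) (\<phi>2 j) x)"
  | j where "j < N" "\<And>x. path p x = leg t (\<theta> (Suc j)) (\<phi>2 j) x" "\<And>x. speed p x = cis (\<theta> (Suc j)) - circ t (\<phi>2 j)"
  using assms unfolding pieces_def by (auto simp: path_def speed_def)

lemma finite_pieces: "finite pieces"
  by (simp add: pieces_def)

lemma path_in_E_dom:
  assumes "p \<in> pieces" "0 < x" "x \<le> 1"
  shows "path p x \<in> E_dom E s"
  using assms(1)
proof (cases rule: path_cases)
  case (1 j)
  then show ?thesis using assms(2,3) t_bounds r by (auto intro!: leg_in_E_dom cis_\<theta>)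
next
  case (2 j)
  then show ?thesis using ball_subset_E_dom[of s E] t_bounds r by (auto simp: circ_def)
next
  case (3 j)
  then show ?thesis using assms(2,3) t_bounds r by (auto intro!: leg_in_E_dom cis_\<theta>)
qed

lemma norm_path_le:
  assumes "p \<in> pieces" "0 < x" "x \<le> 1"
  shows "cmod (path p x) \<le> 1 - (1 - t) * x"
  using assms(1)
proof (cases rule: path_cases)
  case (2 j)
  have "(1 - t) * x \<le> 1 - t" using t_bounds assms by (intro mult_right_le_one_le) auto
  moreover have "cmod (path p x) = t" using t_bounds unfolding 2 by (simp add: circ_def)
  ultimately show ?thesis by simp
qed (use norm_leg_le t_bounds assms in auto)

lemma path_far:
  assumes "p \<in> pieces" "0 < x" "x \<le> 1" "z \<in> E_dom E r"
  shows "(t - r) * x \<le> cmod (z - path p x)"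
proof -
  obtain \<phi> where "(t - r) * x \<le> inner (cis \<phi>) (path p x - z)"
    using inner_path_ge[OF assms] by blast
  also have "\<dots> \<le> cmod (path p x - z)"
    using norm_cauchy_schwarz[of "cis \<phi>" "path p x - z"] by simp
  finally show ?thesis by (simp add: norm_minus_commute)
qed

text \<open>On a leg the corner is within \<open>2 * x\<close> of the contour point, and
  \<open>x \<le> d / (t - r)\<close> by \<open>path_far\<close>, so the triangle inequality bounds
  its distance to \<open>z\<close>. On an arc \<open>d \<ge> t - r\<close>, and any corner will do
  since distances in the disc are at most 2.\<close>

lemma path_corner:
  assumes p: "p \<in> pieces" and x: "0 < x" "x \<le> 1" and z: "z \<in> E_dom E r"
  shows "(\<Prod>\<xi>\<in>E. cmod (\<xi> - z)) \<le> (2 ^ card E * (1 + 2 / (t - r))) * cmod (z - path p x)"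
proof -
  have zb: "z \<in> ball 0 1" using E_dom_subset_ball[OF E_sphere, of r] t_bounds z by auto
  define d where "d = cmod (z - path p x)"
  have "(t - r) * x \<le> d" unfolding d_def by (rule path_far[OF p x z])
  then have d: "x \<le> d / (t - r)" using r by (simp add: pos_le_divide_eq mult.commute)
  have leg: "cmod (cis \<psi> - z) \<le> (1 + 2 / (t - r)) * d" if "path p x = leg t \<psi> \<phi> x" for \<psi> \<phi>
  proof -
    have "cmod (cis \<psi> - path p x) \<le> 2 * x"
      using norm_leg_diff_le[OF t_bounds(5,6), of \<psi> \<phi> 0 x] x unfolding that by simp
    then have "cmod (cis \<psi> - z) \<le> 2 * x + d"
      using norm_triangle_ineq4[of "cis \<psi> - path p x" "z - path p x"] by (simp add: d_def)
    also have "\<dots> \<le> 2 * (d / (t - r)) + d" using d by simp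
    also have "\<dots> = (1 + 2 / (t - r)) * d" by (simp add: algebra_simps)
    finally show ?thesis .
  qed
  have "\<exists>\<xi>0\<in>E. cmod (\<xi>0 - z) \<le> (1 + 2 / (t - r)) * d"
    using p
  proof (cases rule: path_cases)
    case (1 j)
    then show ?thesis by (intro bexI[of _ "cis (\<theta> j)"] leg[OF 1(2)] cis_\<theta>) auto
  next
    case (3 j)
    then show ?thesis by (intro bexI[of _ "cis (\<theta> (Suc j))"] leg[OF 3(2)] cis_\<theta>) auto
  next
    case (2 j)
    let ?\<phi> = "arc_angle (\<phi>1 j) (\<phi>2 j) x"
    have "inner (cis ?\<phi>) z \<le> r"
      using arc_angle_range[OF 2(1), of x] x by (intro support[OF 2(1) _ _ z]) auto
    then have "t - r \<le> inner (cis ?\<phi>) (path p x - z)"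
      by (simp add: 2 circ_def inner_diff_right inner_cis_cis)
    also have "\<dots> \<le> d"
      using norm_cauchy_schwarz[of "cis ?\<phi>" "path p x - z"] by (simp add: d_def norm_minus_commute)
    finally have "2 \<le> 2 / (t - r) * d" using r by (simp add: field_simps)
    moreover have "0 \<le> d" by (simp add: d_def)
    moreover have "cmod (cis (\<theta> j) - z) \<le> 2"
      using norm_triangle_ineq4[of "cis (\<theta> j)" z] zb by simp
    ultimately have "cmod (cis (\<theta> j) - z) \<le> (1 + 2 / (t - r)) * d"
      by (simp add: distrib_right)
    then show ?thesis using 2(1) by (intro bexI[of _ "cis (\<theta> j)"] cis_\<theta>) auto
  qed
  then obtain \<xi>0 where \<xi>0: "\<xi>0 \<in> E" "cmod (\<xi>0 - z) \<le> (1 + 2 / (t - r)) * d" by blast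
  have "(\<Prod>\<xi>\<in>E. cmod (\<xi> - z)) \<le> 2 ^ card E * cmod (\<xi>0 - z)"
    by (rule prod_dist_le[OF finite_E E_sphere \<xi>0(1) zb])
  also have "\<dots> \<le> 2 ^ card E * ((1 + 2 / (t - r)) * d)"
    using \<xi>0(2) by (intro mult_left_mono) auto
  finally show ?thesis by (simp add: d_def mult.assoc)
qed

text \<open>Legs have length at most 2 and arcs sweep at most \<open>2 * pi\<close>; 8 covers both
  since \<open>pi < 4\<close>.\<close>

lemma path_Lipschitz:
  assumes p: "p \<in> pieces"
  shows "cmod (path p x - path p y) \<le> 8 * \<bar>x - y\<bar>"
proof -
  have le: "2 * \<bar>x - y\<bar> \<le> 8 * \<bar>x - y\<bar>" by simp
  show ?thesis
    using p
  proof (cases rule: path_cases)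
    case (1 j)
    show ?thesis unfolding 1 by (rule order_trans[OF norm_leg_diff_le[OF t_bounds(5,6)] le])
  next
    case (2 j)
    let ?a = "arc_angle (\<phi>1 j) (\<phi>2 j)"
    have "cmod (path p x - path p y) = t * cmod (cis (?a x) - cis (?a y))"
      using t_bounds unfolding 2 circ_def by (simp flip: scaleR_diff_right)
    also have "\<dots> \<le> 1 * \<bar>?a x - ?a y\<bar>"
      using t_bounds by (intro mult_mono norm_cis_diff_le) auto
    also have "?a x - ?a y = (x - y) * (\<phi>2 j - \<phi>1 j)" by (simp add: arc_angle_def algebra_simps)
    also have "1 * \<bar>(x - y) * (\<phi>2 j - \<phi>1 j)\<bar> = \<bar>x - y\<bar> * (\<phi>2 j - \<phi>1 j)"
      using arc_range(1)[OF 2(1)] by (simp add: abs_mult)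
    also have "\<dots> \<le> \<bar>x - y\<bar> * 8"
      using arc_range(2)[OF 2(1)] pi_less_4 by (intro mult_left_mono) auto
    finally show ?thesis by simp
  next
    case (3 j)
    show ?thesis unfolding 3 by (rule order_trans[OF norm_leg_diff_le[OF t_bounds(5,6)] le])
  qed
qed

lemma speed_bound:
  assumes p: "p \<in> pieces"
  shows "cmod (speed p x) \<le> 8"
  using p
proof (cases rule: path_cases)
  case (1 j)
  then show ?thesis using norm_circ_minus_cis_le[of t "\<phi>1 j" "\<theta> j"] t_bounds by simp
next
  case (2 j)
  have "\<bar>\<phi>2 j - \<phi>1 j\<bar> * t \<le> 8 * 1"
    using arc_range[OF 2(1)] pi_less_4 t_bounds by (intro mult_mono) auto
  then show ?thesis using t_bounds unfolding 2 circ_def by (simp add: norm_mult mult.commute del: of_real_diff)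
next
  case (3 j)
  then show ?thesis using norm_circ_minus_cis_le[of t "\<phi>2 j" "\<theta> (Suc j)"] t_bounds
    by (simp add: norm_minus_commute)
qed

lemma speed_cont:
  assumes p: "p \<in> pieces"
  shows "continuous_on S (speed p)"
  using p
  by (cases rule: path_cases) (auto simp: fun_eq_iff circ_def arc_angle_def intro!: continuous_intros cong: continuous_on_cong)

text \<open>Every truncated piece contributes a difference of values of \<open>V\<close>. Around the
  contour the contributions telescope up to the full turn, which yields
  \<open>2 \<pi> \<i> * H z\<close>, the gaps at the corners and the omitted beginnings of the arcs;
  the last two vanish in the limit.\<close>

lemma contour_limit:
  assumes f: "f holomorphic_on E_dom E s" and fb: "bounded (f ` E_dom E s)" and z: "z \<in> E_dom E r"
  shows "((\<lambda>\<epsilon>. \<Sum>p\<in>pieces. integral {\<epsilon>..1}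
      (\<lambda>x. f (path p x) / corner_weight E (path p x) * speed p x / (path p x - z)))
    \<longlongrightarrow> 2 * of_real pi * \<i> * (f z / corner_weight E z)) (at_right 0)"
proof -
  let ?U = "E_dom E s"
  define H where "H w = f w / corner_weight E w" for w
  have Ub: "?U \<subseteq> ball 0 1" using E_dom_subset_ball[OF E_sphere] r by simp
  have zU: "z \<in> ?U" and zb: "cmod z < 1"
    using z E_dom_mono[of r s E] Ub t_bounds by auto
  have Hh: "H holomorphic_on ?U"
    unfolding H_def[abs_def] using corner_weight_nonzero[OF finite_E E_sphere] Ub
    by (intro holomorphic_intros f holomorphic_on_subset[OF holomorphic_corner_weight[OF E_sphere]]) auto
  obtain Q where Q: "\<And>w. w \<in> ?U \<Longrightarrow> w \<noteq> z \<Longrightarrow> (Q has_field_derivative (H w - H z) / (w - z)) (at w)"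
    using difference_quotient_primitive[OF Hh E_dom_open E_dom_convex] by blast
  define \<Lambda> where "\<Lambda> \<phi> w = Ln ((w - z) * cis (- \<phi>)) + \<i> * of_real \<phi>" for \<phi> w
  define V where "V \<phi> w = Q w + H z * (Ln ((w - z) * cis (- \<phi>)) + \<i> * of_real \<phi>)" for \<phi> w
  have V: "V \<phi> w = Q w + H z * \<Lambda> \<phi> w" for \<phi> w by (simp add: V_def \<Lambda>_def)
  \<comment> \<open>\<open>X j\<close> belongs to the leg arriving at corner \<open>j\<close>,
    \<open>Y j\<close> to the leg leaving it, and \<open>A j\<close> follows the arc after
    it.\<close>
  define X where "X j \<epsilon> = V (\<theta> j - \<beta>) (leg t (\<theta> j) (\<theta> j - \<beta>) \<epsilon>)" for j \<epsilon>
  define Y where "Y j \<epsilon> = V (\<phi>1 j) (leg t (\<theta> j) (\<phi>1 j) \<epsilon>)" for j \<epsilon>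
  define A where "A j \<epsilon> = V (arc_angle (\<phi>1 j) (\<phi>2 j) \<epsilon>) (circ t (arc_angle (\<phi>1 j) (\<phi>2 j) \<epsilon>))" for j \<epsilon>
  let ?I = "\<lambda>p \<epsilon>. integral {\<epsilon>..1} (\<lambda>x. H (path p x) * speed p x / (path p x - z))"

  have half: "0 < inner (cis \<phi>) (leg t \<psi> \<phi> x - z)"
    if "inner (cis \<phi>) z \<le> r" "cos (\<phi> - \<psi>) = r" "0 < x" for \<phi> \<psi> x
  proof -
    have "0 < x * (t - r)" using that r by simp
    moreover have "inner (cis \<phi>) (leg t \<psi> \<phi> x - z) = x * (t - r) + (r - inner (cis \<phi>) z)"
      using that by (simp add: inner_diff_right inner_leg algebra_simps)
    ultimately show ?thesis using that by simp
  qed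
  have leg_integral: "((\<lambda>x. H (leg t \<psi> \<phi> x) * (circ t \<phi> - cis \<psi>) / (leg t \<psi> \<phi> x - z)) has_integral
      V \<phi> (circ t \<phi>) - V \<phi> (leg t \<psi> \<phi> \<epsilon>)) {\<epsilon>..1}"
    if "inner (cis \<phi>) z \<le> r" "cos (\<phi> - \<psi>) = r" "cis \<psi> \<in> E" "0 < \<epsilon>" "\<epsilon> \<le> 1" for \<phi> \<psi> \<epsilon>
  proof -
    have "((\<lambda>x. H (leg t \<psi> \<phi> x) * (circ t \<phi> - cis \<psi>) / (leg t \<psi> \<phi> x - z)) has_integral
      V \<phi> (leg t \<psi> \<phi> 1) - V \<phi> (leg t \<psi> \<phi> \<epsilon>)) {\<epsilon>..1}"
      by (rule integral_along_path[where U = ?U and \<phi>' = "\<lambda>_. 0", OF _ has_vector_derivative_leg _ _ _ Q V_def])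
        (use that t_bounds r in \<open>auto intro!: half leg_in_E_dom\<close>)
    then show ?thesis by simp
  qed
  have arc_integral: "((\<lambda>x. H (circ t (arc_angle (\<phi>1 j) (\<phi>2 j) x)) *
        (\<i> * of_real (\<phi>2 j - \<phi>1 j) * circ t (arc_angle (\<phi>1 j) (\<phi>2 j) x)) /
        (circ t (arc_angle (\<phi>1 j) (\<phi>2 j) x) - z)) has_integral A j b - A j a) {a..b}"
    if j: "j < N" and ab: "0 \<le> a" "a \<le> b" "b \<le> 1" for j a b
    unfolding A_def
  proof (rule integral_along_path[where U = ?U, OF ab(2) has_vector_derivative_circ_arc
        has_real_derivative_arc_angle _ _ Q V_def])
    fix x assume x: "x \<in> {a..b}"
    let ?\<phi> = "arc_angle (\<phi>1 j) (\<phi>2 j) x"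
    show "circ t ?\<phi> \<in> ?U" using ball_subset_E_dom[of s E] t_bounds r by (auto simp: circ_def)
    have "inner (cis ?\<phi>) z \<le> r"
      using arc_angle_range[OF j, of x] x ab by (intro support[OF j _ _ z]) auto
    then show "0 < inner (cis ?\<phi>) (circ t ?\<phi> - z)"
      using r by (simp add: circ_def inner_diff_right inner_cis_cis)
  qed
  have A1: "A j 1 = V (\<phi>2 j) (circ t (\<phi>2 j))" and A0: "A j 0 = V (\<phi>1 j) (circ t (\<phi>1 j))" for j
    by (simp_all add: A_def arc_angle_def)
  have sum_eq: "(\<Sum>p\<in>pieces. ?I p \<epsilon>) = 2 * of_real pi * \<i> * H z +
      (\<Sum>j<N. (X j \<epsilon> - Y j \<epsilon>) + (A j 0 - A j \<epsilon>))" if \<epsilon>: "0 < \<epsilon>" "\<epsilon> \<le> 1" for \<epsilon>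
  proof -
    have "?I (j, 0) \<epsilon> + ?I (j, 1) \<epsilon> + ?I (j, 2) \<epsilon> = (A j 0 - A j \<epsilon>) + (X (Suc j) \<epsilon> - Y j \<epsilon>)"
      if j: "j < N" for j
    proof -
      have "?I (j, 0) \<epsilon> = A j 0 - Y j \<epsilon>"
      proof -
        have "((\<lambda>x. H (leg t (\<theta> j) (\<phi>1 j) x) * (circ t (\<phi>1 j) - cis (\<theta> j)) /
            (leg t (\<theta> j) (\<phi>1 j) x - z)) has_integral A j 0 - Y j \<epsilon>) {\<epsilon>..1}"
          unfolding A0 Y_def using j \<epsilon> arc_range[OF j] \<beta>
          by (intro leg_integral support[OF j _ _ z] cis_\<theta>) auto
        from integral_unique[OF this] show ?thesis by (simp add: path_def speed_def)
      qed
      moreover have "?I (j, 1) \<epsilon> = A j 1 - A j \<epsilon>"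
        using integral_unique[OF arc_integral[OF j, of \<epsilon> 1]] \<epsilon> by (simp add: path_def speed_def)
      moreover have "?I (j, 2) \<epsilon> = - (A j 1 - X (Suc j) \<epsilon>)"
      proof -
        have "((\<lambda>x. H (leg t (\<theta> (Suc j)) (\<phi>2 j) x) * (circ t (\<phi>2 j) - cis (\<theta> (Suc j))) /
            (leg t (\<theta> (Suc j)) (\<phi>2 j) x - z)) has_integral A j 1 - X (Suc j) \<epsilon>) {\<epsilon>..1}"
          unfolding A1 X_def using j \<epsilon> arc_range[OF j] \<beta>
          by (intro leg_integral support[OF j _ _ z] cis_\<theta>) auto
        from integral_unique[OF this]
        have val: "integral {\<epsilon>..1} (\<lambda>x. H (leg t (\<theta> (Suc j)) (\<phi>2 j) x) * (circ t (\<phi>2 j) - cis (\<theta> (Suc j))) /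
            (leg t (\<theta> (Suc j)) (\<phi>2 j) x - z)) = A j 1 - X (Suc j) \<epsilon>" .
        have neg: "h * (a - b) / c = - (h * (b - a) / c)" for h a b c :: complex
          by (metis minus_diff_eq minus_divide_left mult_minus_right)
        show ?thesis
          using val by (simp add: path_def speed_def neg[of _ "cis (\<theta> (Suc j))"])
      qed
      ultimately show ?thesis by simp
    qed
    then have "(\<Sum>p\<in>pieces. ?I p \<epsilon>) = (\<Sum>j<N. (A j 0 - A j \<epsilon>) + (X (Suc j) \<epsilon> - Y j \<epsilon>))"
      unfolding pieces_def by (simp add: sum.cartesian_product' add.assoc)
    \<comment> \<open>Regrouping from gaps to corners: \<open>Y j\<close> is paired with the
      arriving leg at the same corner, at the price of a telescoping sum.\<close>
    also have "\<dots> = (\<Sum>j<N. X (Suc j) \<epsilon> - X j \<epsilon>) + (\<Sum>j<N. (X j \<epsilon> - Y j \<epsilon>) + (A j 0 - A j \<epsilon>))"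
      by (simp add: sum.distrib[symmetric] algebra_simps)
    also have "(\<Sum>j<N. X (Suc j) \<epsilon> - X j \<epsilon>) = X N \<epsilon> - X 0 \<epsilon>"
      by (rule sum_lessThan_telescope)
    \<comment> \<open>\<open>X N\<close> and \<open>X 0\<close> involve the same point; only the
      summand \<open>\<i> * \<phi>\<close> of the logarithm sees the extra turn.\<close>
    also have "\<dots> = 2 * of_real pi * \<i> * H z"
    proof -
      have "cis (- (\<phi> + 2 * pi)) = cis (- \<phi>)" for \<phi>
        using cis_add_2pi[of "- \<phi> - 2 * pi"] by simp
      then have "V (\<phi> + 2 * pi) w = V \<phi> w + 2 * of_real pi * \<i> * H z" for \<phi> w
        by (simp only: V_def of_real_add) (simp add: algebra_simps)
      moreover have "leg t (a + 2 * pi) (b + 2 * pi) \<epsilon> = leg t a b \<epsilon>" for a b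
        by (simp add: leg_def)
      moreover have "\<theta> N - \<beta> = (\<theta> 0 - \<beta>) + 2 * pi" using \<theta>_N by simp
      ultimately show ?thesis
        by (simp only: X_def \<theta>_N) simp
    qed
    finally show ?thesis .
  qed
  have XY: "((\<lambda>\<epsilon>. X j \<epsilon> - Y j \<epsilon>) \<longlongrightarrow> 0) (at_right 0)" if j: "j < N" for j
  proof -
    have \<beta>': "\<bar>\<beta>\<bar> < pi / 2" "\<bar>- \<beta>\<bar> < pi / 2" using \<beta> by auto
    have "((\<lambda>\<epsilon>. Q (leg t (\<theta> j) (\<theta> j - \<beta>) \<epsilon>) - Q (leg t (\<theta> j) (\<phi>1 j) \<epsilon>)) \<longlongrightarrow> 0) (at_right 0)"
    proof -
      obtain M where M: "M > 0" "\<And>w. w \<in> ?U \<Longrightarrow> cmod (f w) \<le> M"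
        using fb unfolding bounded_pos by auto
      obtain c where c: "c > 0" and
        cd: "\<And>w d. 0 \<le> d \<Longrightarrow> d \<le> 1 \<Longrightarrow> (\<forall>\<xi>\<in>E. d \<le> cmod (\<xi> - w)) \<Longrightarrow> c * d \<le> (\<Prod>\<xi>\<in>E. cmod (\<xi> - w))"
        using prod_dist_lower_bound[OF finite_E] by blast
      show ?thesis
      proof (rule primitive_gap_tendsto[OF E_dom_convex[of E s] _ _ Q])
        show "z \<noteq> cis (\<theta> j)" using zb by auto
        \<comment> \<open>At distance \<open>d\<close> from the unit circle the weight is at least
          \<open>sqrt (c * d)\<close>, and \<open>f\<close> is bounded by \<open>M\<close>.\<close>
        show "M / sqrt c > 0" "1 - t > 0" using M c t_bounds by auto
        fix w d assume w: "w \<in> ?U" and d: "0 < d" "d \<le> 1 - cmod w"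
        have "d \<le> cmod (\<xi> - w)" if "\<xi> \<in> E" for \<xi>
          using norm_triangle_ineq2[of \<xi> w] that E_sphere d by auto
        moreover have "d \<le> 1" using d norm_ge_zero[of w] by linarith
        ultimately have "c * d \<le> (cmod (corner_weight E w))\<^sup>2"
          unfolding norm_corner_weight_sq[OF E_sphere] using d by (intro cd) auto
        then have "sqrt (c * d) \<le> cmod (corner_weight E w)"
          by (simp add: real_le_lsqrt)
        then show "cmod (H w) \<le> M / sqrt c / sqrt d"
          unfolding H_def norm_divide divide_divide_eq_left real_sqrt_mult[symmetric]
          using M w c d by (intro frac_le) auto
      next
        fix x :: real assume x: "0 < x" "x \<le> 1"
        have *: "leg t (\<theta> j) \<phi> x \<in> ?U \<and> cmod (leg t (\<theta> j) \<phi> x) \<le> 1 - (1 - t) * x \<and>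
            cmod (leg t (\<theta> j) \<phi> x - cis (\<theta> j)) \<le> 2 * x" for \<phi>
          using norm_leg_diff_le[of t "\<theta> j" \<phi> x 0] x t_bounds r j
          by (auto intro!: norm_leg_le leg_in_E_dom cis_\<theta>)
        show "leg t (\<theta> j) (\<theta> j - \<beta>) x \<in> ?U \<and> leg t (\<theta> j) (\<phi>1 j) x \<in> ?U \<and>
          cmod (leg t (\<theta> j) (\<theta> j - \<beta>) x) \<le> 1 - (1 - t) * x \<and> cmod (leg t (\<theta> j) (\<phi>1 j) x) \<le> 1 - (1 - t) * x \<and>
          cmod (leg t (\<theta> j) (\<theta> j - \<beta>) x - cis (\<theta> j)) \<le> 2 * x \<and> cmod (leg t (\<theta> j) (\<phi>1 j) x - cis (\<theta> j)) \<le> 2 * x"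
          using *[of "\<theta> j - \<beta>"] *[of "\<phi>1 j"] by simp
      qed
    qed
    moreover have "((\<lambda>\<epsilon>. \<Lambda> (\<theta> j - \<beta>) (leg t (\<theta> j) (\<theta> j - \<beta>) \<epsilon>) - \<Lambda> (\<phi>1 j) (leg t (\<theta> j) (\<phi>1 j) \<epsilon>)) \<longlongrightarrow>
        (Ln ((cis (\<theta> j) - z) * cis (- \<theta> j)) + \<i> * of_real (\<theta> j)) -
        (Ln ((cis (\<theta> j) - z) * cis (- \<theta> j)) + \<i> * of_real (\<theta> j))) (at_right 0)"
      using corner_log_tendsto[OF zb \<beta>'(1), of t "\<theta> j"] corner_log_tendsto[OF zb \<beta>'(2), of t "\<theta> j"]
      unfolding \<Lambda>_def by (intro tendsto_diff) auto
    ultimately have "((\<lambda>\<epsilon>. (Q (leg t (\<theta> j) (\<theta> j - \<beta>) \<epsilon>) - Q (leg t (\<theta> j) (\<phi>1 j) \<epsilon>)) +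
        H z * (\<Lambda> (\<theta> j - \<beta>) (leg t (\<theta> j) (\<theta> j - \<beta>) \<epsilon>) - \<Lambda> (\<phi>1 j) (leg t (\<theta> j) (\<phi>1 j) \<epsilon>)))
        \<longlongrightarrow> 0 + H z * ((Ln ((cis (\<theta> j) - z) * cis (- \<theta> j)) + \<i> * of_real (\<theta> j)) -
        (Ln ((cis (\<theta> j) - z) * cis (- \<theta> j)) + \<i> * of_real (\<theta> j)))) (at_right 0)"
      by (intro tendsto_add tendsto_mult tendsto_const)
    then show ?thesis by (simp add: X_def Y_def V algebra_simps)
  qed
  have A_lim: "((\<lambda>\<epsilon>. A j 0 - A j \<epsilon>) \<longlongrightarrow> 0) (at_right 0)" if j: "j < N" for j
  proof -
    let ?i = "\<lambda>x. H (circ t (arc_angle (\<phi>1 j) (\<phi>2 j) x)) *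
        (\<i> * of_real (\<phi>2 j - \<phi>1 j) * circ t (arc_angle (\<phi>1 j) (\<phi>2 j) x)) /
        (circ t (arc_angle (\<phi>1 j) (\<phi>2 j) x) - z)"
    \<comment> \<open>Continuity of \<open>A j\<close> at 0 is read off from the indefinite
      integral, of which it is the value up to a constant.\<close>
    have "continuous_on {0..1} (\<lambda>\<epsilon>. integral {0..\<epsilon>} ?i)"
      using arc_integral[OF j, of 0 1] by (intro indefinite_integral_continuous_1) (auto simp: integrable_on_def)
    moreover have "integral {0..\<epsilon>} ?i = A j \<epsilon> - A j 0" if "\<epsilon> \<in> {0..1}" for \<epsilon>
      using arc_integral[OF j, of 0 \<epsilon>] that by (intro integral_unique) auto
    ultimately have "continuous_on {0..1} (\<lambda>\<epsilon>. A j \<epsilon> - A j 0)"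
      by (rule continuous_on_cong[THEN iffD1, OF refl, rotated]) auto
    then have "((\<lambda>\<epsilon>. A j \<epsilon> - A j 0) \<longlongrightarrow> 0) (at 0 within {0..1})"
      by (auto simp: continuous_on_def dest!: bspec[of _ _ 0])
    then have "((\<lambda>\<epsilon>. A j \<epsilon> - A j 0) \<longlongrightarrow> 0) (at_right 0)"
      by (simp add: at_within_Icc_at_right)
    from tendsto_minus[OF this] show ?thesis by simp
  qed
  have "((\<lambda>\<epsilon>. 2 * of_real pi * \<i> * H z + (\<Sum>j<N. (X j \<epsilon> - Y j \<epsilon>) + (A j 0 - A j \<epsilon>))) \<longlongrightarrow>
      2 * of_real pi * \<i> * H z + (\<Sum>j<N. 0 + 0)) (at_right 0)"
    by (intro tendsto_add tendsto_const tendsto_sum XY A_lim) auto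
  then have lim: "((\<lambda>\<epsilon>. 2 * of_real pi * \<i> * H z + (\<Sum>j<N. (X j \<epsilon> - Y j \<epsilon>) + (A j 0 - A j \<epsilon>))) \<longlongrightarrow>
      2 * of_real pi * \<i> * H z) (at_right 0)"
    by simp
  have "\<forall>\<^sub>F \<epsilon> in at_right 0. 2 * of_real pi * \<i> * H z + (\<Sum>j<N. (X j \<epsilon> - Y j \<epsilon>) + (A j 0 - A j \<epsilon>)) =
      (\<Sum>p\<in>pieces. ?I p \<epsilon>)"
    using eventually_at_right_real[of 0 1, OF zero_less_one]
    by eventually_elim (rule sum_eq[symmetric], auto)
  then have "((\<lambda>\<epsilon>. \<Sum>p\<in>pieces. ?I p \<epsilon>) \<longlongrightarrow> 2 * of_real pi * \<i> * H z) (at_right 0)"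
    by (rule Lim_transform_eventually[OF lim])
  then show ?thesis unfolding H_def .
qed

end

section \<open>The decomposition\<close>

lemma norm_corner_weight_le:
  assumes "E \<subseteq> sphere 0 1" "z \<in> ball 0 1"
  shows "cmod (corner_weight E z) \<le> 2 ^ card E"
proof -
  have "cmod (\<xi> - z) powr (1 / 2) \<le> 2" if "\<xi> \<in> E" for \<xi>
  proof -
    have "cmod (\<xi> - z) \<le> 2" using norm_triangle_ineq4[of \<xi> z] that assms by auto
    then show ?thesis by (simp add: powr_half_sqrt real_le_lsqrt)
  qed
  then have "cmod (corner_weight E z) \<le> (\<Prod>\<xi>\<in>E. 2)"
    unfolding norm_corner_weight[OF assms(1)] by (intro prod_mono) auto
  then show ?thesis by simp
qed

lemma H0_inf_I:
  assumes "\<phi> holomorphic_on E_dom E r" "E \<subseteq> sphere 0 1" "r \<le> 1" "K > 0"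
    and le: "\<And>z. z \<in> E_dom E r \<Longrightarrow> cmod (\<phi> z) \<le> K * cmod (corner_weight E z)"
  shows "\<phi> \<in> H0_inf E r"
proof -
  have "cmod (\<phi> z) \<le> K * 2 ^ card E" if "z \<in> E_dom E r" for z
  proof -
    have "cmod (corner_weight E z) \<le> 2 ^ card E"
      using E_dom_subset_ball[OF assms(2,3)] that by (intro norm_corner_weight_le assms) auto
    then show ?thesis using le[OF that] assms(4) by (meson mult_left_mono less_imp_le order_trans)
  qed
  then have "bounded (\<phi> ` E_dom E r)" by (auto simp: bounded_iff)
  moreover have "\<exists>C\<^sub>1>0. \<exists>s :: complex \<Rightarrow> real. (\<forall>\<xi>\<in>E. s \<xi> > 0) \<and>
      (\<forall>z\<in>E_dom E r. cmod (\<phi> z) \<le> C\<^sub>1 * (\<Prod>\<xi>\<in>E. cmod (\<xi> - z) powr s \<xi>))"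
    using le assms(4) by (intro exI[of _ K] conjI exI[of _ "\<lambda>_. 1 / 2"]) (auto simp: norm_corner_weight[OF assms(2)])
  ultimately show ?thesis using assms(1) by (simp add: H0_inf_def)
qed

text \<open>Two points at angular distance \<open>2 * d < 2 * \<beta>\<close> span a chord on the
  line at level \<open>cos d > cos \<beta>\<close> in the bisecting direction, so the chord misses
  the ball.\<close>

lemma angular_gap:
  assumes large: "E_large_enough E (cos \<beta>)" and "0 < \<beta>" "\<beta> < pi / 2"
    and ab: "cis a \<in> E" "cis b \<in> E" "a < b"
  shows "a + 2 * \<beta> \<le> b"
proof (rule ccontr)
  assume "\<not> a + 2 * \<beta> \<le> b"
  then have b: "b < a + 2 * \<beta>" by simp
  define d where "d = (b - a) / 2"
  have d: "0 < d" "d < \<beta>" using ab b by (auto simp: d_def)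
  have cd: "cos \<beta> < cos d" using d assms(3) by (intro cos_monotone_0_pi) auto
  let ?u = "cis ((a + b) / 2)"
  have u: "inner ?u (cis a) = cos d" "inner ?u (cis b) = cos d"
  proof -
    have "(a + b) / 2 - a = d" "(a + b) / 2 - b = - d" by (simp_all add: d_def field_simps)
    then show "inner ?u (cis a) = cos d" "inner ?u (cis b) = cos d"
      by (simp_all only: inner_cis_cis cos_minus)
  qed
  \<comment> \<open>Largeness speaks only of distinct points, while the angles may name the same
    point one turn apart, as they do when \<open>E\<close> is a singleton.\<close>
  have "cis a \<noteq> cis b"
  proof
    assume "cis a = cis b"
    then have "cos (b - a) = 1" by (simp flip: inner_cis_cis) (simp add: inner_cis_cis)
    moreover have "b - a = 2 * d" by (simp add: d_def)
    ultimately have "cos (2 * d) = 1" by simp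
    then have "sin d = 0" by (simp add: cos_double_sin)
    moreover have "sin d > 0" using d assms(3) by (intro sin_gt_zero) auto
    ultimately show False by simp
  qed
  then obtain w where w: "w \<in> closed_segment (cis a) (cis b)" "w \<in> ball 0 (cos \<beta>)"
    using large ab(1,2) unfolding E_large_enough_def by blast
  then obtain v where "w = (1 - v) *\<^sub>R cis a + v *\<^sub>R cis b" by (auto simp: in_segment)
  then have "inner ?u w = (1 - v) * cos d + v * cos d" by (simp only: inner_add_right inner_scaleR_right u)
  then have "inner ?u w = cos d" by (simp add: algebra_simps)
  moreover have "inner ?u w \<le> norm w" using norm_cauchy_schwarz[of ?u w] by simp
  ultimately show False using w(2) cd by simp
qed

theorem proposition4p6:
  fixes E :: "complex set" and r s :: real
  assumes "finite E" and "E \<noteq> {}" and "E \<subseteq> sphere 0 1"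
    and "0 < r" and "r < 1" and "E_large_enough E r"
    and "r < s" and "s < 1"
  shows "\<exists>C>0. \<exists>\<Phi> :: nat \<Rightarrow> complex \<Rightarrow> complex.
    (\<forall>i. \<Phi> i \<in> H0_inf E r) \<and>
    (SUP z\<in>E_dom E r. \<Sum>i. ennreal (cmod (\<Phi> i z) powr (1/2))) < \<infinity> \<and>
    (\<forall>h :: complex \<Rightarrow> 'z::complex_banach. h \<in> H_inf (E_dom E s) \<longrightarrow>
      (\<exists>\<alpha> :: nat \<Rightarrow> 'z. bounded (range \<alpha>) \<and>
        (\<forall>z\<in>E_dom E r. (\<lambda>i. \<Phi> i z *\<^sub>C \<alpha> i) sums h z) \<and>
        (\<forall>i. norm (\<alpha> i) \<le> C * H_inf_norm (E_dom E s) h)))"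
proof -
  define t where "t = (r + s) / 2"
  define \<beta> where "\<beta> = arccos r"
  \<comment> \<open>Bernoulli's inequality gives
    \<open>8 * (1 - \<rho> ^ 4) \<le> 8 * 4 * (t - r) / 64\<close>, which is the required
    \<open>(t - r) / 2\<close> for the Lipschitz constant 8.\<close>
  define \<rho> where "\<rho> = 1 - (t - r) / 64"
  have \<beta>: "cos \<beta> = r" "0 < \<beta>" "\<beta> < pi / 2"
    using assms arccos_less_arccos[of r 1] arccos_less_arccos[of 0 r] by (auto simp: \<beta>_def)
  obtain N and \<theta> :: "nat \<Rightarrow> real" where N: "N > 0" and \<theta>: "\<And>j. j < N \<Longrightarrow> \<theta> j < \<theta> (Suc j)"
    "\<theta> N = \<theta> 0 + 2 * pi" "E = (\<lambda>j. cis (\<theta> j)) ` {..<N}"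
    by (rule sorted_angles[OF assms(1-3)]) blast
  have cis_\<theta>: "cis (\<theta> j) \<in> E" if "j \<le> N" for j
    using that N \<theta>(2,3) by (cases "j = N") auto
  interpret corner_data E r s t \<beta> N \<theta>
  proof
    fix j assume "j < N"
    then show "\<theta> j + 2 * \<beta> \<le> \<theta> (Suc j)"
      using \<theta>(1) \<beta> assms(6) by (intro angular_gap[of E]) (auto intro!: cis_\<theta>)
  qed (use assms \<beta> N \<theta> in \<open>auto simp: t_def\<close>)
  have \<rho>: "0 < \<rho>" "\<rho> < 1" using r by (auto simp: \<rho>_def)
  have ratio: "8 * (1 - \<rho> ^ 4) \<le> (t - r) / 2"
  proof -
    have "1 + 4 * (- ((t - r) / 64)) \<le> \<rho> ^ 4"
      using Bernoulli_inequality[of "- ((t - r) / 64)" 4] r by (simp add: \<rho>_def)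
    then show ?thesis by argo
  qed
  have lim: "filterlim (\<lambda>n. \<rho> ^ (4 * n)) (at_right 0) sequentially"
    unfolding power_mult filterlim_at
    using \<rho> by (auto intro!: always_eventually LIMSEQ_realpow_zero power_less_one_iff[THEN iffD2])
  interpret reproducing_contour E "E_dom E r" "E_dom E s" pieces path speed "t - r" "1 - t" 8
    "2 ^ card E * (1 + 2 / (t - r))" \<rho>
  proof
    show "E_dom E s \<noteq> {}" using ball_subset_E_dom[of s E] r by auto
    fix f z assume "f holomorphic_on E_dom E s" "bounded (f ` E_dom E s)" "z \<in> E_dom E r"
    from filterlim_compose[OF contour_limit[OF this] lim]
    show "(\<lambda>n. \<Sum>p\<in>pieces. integral {\<rho> ^ (4 * n)..1}
        (\<lambda>x. f (path p x) / corner_weight E (path p x) * speed p x / (path p x - z)))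
      \<longlonglongrightarrow> 2 * of_real pi * \<i> * (f z / corner_weight E z)" .
  qed (use r \<rho> ratio finite_E E_sphere finite_pieces E_dom_mono E_dom_subset_ball path_in_E_dom norm_path_le path_far
      path_corner path_Lipschitz speed_cont speed_bound in
      \<open>auto intro!: mult_pos_pos add_pos_pos simp: algebra_simps\<close>)
  obtain C where C: "C > 0" and \<alpha>_le: "\<And>(h :: complex \<Rightarrow> 'z) i. h \<in> H_inf (E_dom E s) \<Longrightarrow>
      norm (\<alpha> h i) \<le> C * H_inf_norm (E_dom E s) h"
    using \<alpha>_bound by blast
  have "\<Phi> i \<in> H0_inf E r" for i
  proof -
    obtain K where "K > 0" "\<forall>z\<in>E_dom E r. cmod (\<Phi> i z) \<le> K * cmod (corner_weight E z)"
      using \<Phi>_le_weight by blast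
    then show ?thesis using \<Phi>_holomorphic assms(3,5) by (intro H0_inf_I[of _ _ _ K]) auto
  qed
  moreover have "(SUP z\<in>E_dom E r. \<Sum>i. ennreal (cmod (\<Phi> i z) powr (1/2))) < \<infinity>"
  proof -
    have "(\<Sum>i. ennreal (cmod (\<Phi> i z) powr (1/2))) \<le> ennreal sum_const" if "z \<in> E_dom E r" for z
      unfolding suminf_eq_SUP
      by (intro SUP_least) (simp add: powr_half_sqrt sum_ennreal ennreal_leI sum_sqrt_\<Phi>_le[OF that])
    then have "(SUP z\<in>E_dom E r. \<Sum>i. ennreal (cmod (\<Phi> i z) powr (1/2))) \<le> ennreal sum_const"
      by (intro SUP_least)
    also have "\<dots> < \<infinity>" by simp
    finally show ?thesis .
  qed
  moreover have "\<exists>\<alpha> :: nat \<Rightarrow> 'z. bounded (range \<alpha>) \<and>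
        (\<forall>z\<in>E_dom E r. (\<lambda>i. \<Phi> i z *\<^sub>C \<alpha> i) sums h z) \<and>
        (\<forall>i. norm (\<alpha> i) \<le> C * H_inf_norm (E_dom E s) h)"
    if h: "h \<in> H_inf (E_dom E s)" for h :: "complex \<Rightarrow> 'z"
    using \<alpha>_le[OF h] decomposition_sums[OF h]
    by (intro exI[of _ "\<alpha> h"]) (auto simp: bounded_iff)
  ultimately show ?thesis using C by blast
qed

end
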